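(* There exist a rigid weak mixing invertible measure preserving transformation $T$ on a Lebesgue probability space $(X,\mathcal{B},\mu)$ and a measurable set $A$ such that for all $n\in\mathbb{Z}$, $$\mu(T^nA\cap A)>\mu(A)^2.$$
   Context: A Lebesgue probability space is a (non-atomic) standard probability space, i.e. isomorphic mod null sets to $[0,1]$ with Lebesgue measure. $T$ is rigid if there is a sequence of natural numbers $n_k\to\infty$ such that $\lim_{k\to\infty}\mu(T^{n_k}B\triangle B)=0$ for every measurable set $B$. $T$ is weak mixing if $\lim_{N\to\infty}\frac1N\sum_{n=0}^{N-1}|\mu(T^nB\cap C)-\mu(B)\mu(C)|=0$ for all measurable $B,C$. *)

theory Defs
  imports "HOL-Probability.Probability"
begin

definition measure_isomorphic :: "'a measure \<Rightarrow> 'b measure \<Rightarrow> bool" where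
  "measure_isomorphic M N \<longleftrightarrow>
     (\<exists>f g. f \<in> M \<rightarrow>\<^sub>M N \<and> g \<in> N \<rightarrow>\<^sub>M M \<and>
        (\<forall>x\<in>space M. g (f x) = x) \<and> (\<forall>y\<in>space N. f (g y) = y) \<and>
        distr M N f = N)"

definition isomorphic_mod_null :: "'a measure \<Rightarrow> 'b measure \<Rightarrow> bool" where
  "isomorphic_mod_null M N \<longleftrightarrow>
     (\<exists>A\<in>null_sets M. \<exists>B\<in>null_sets N.
        measure_isomorphic (restrict_space M (space M - A)) (restrict_space N (space N - B)))"

definition Lebesgue_prob_space :: "'a measure \<Rightarrow> bool" where
  "Lebesgue_prob_space M \<longleftrightarrow>
     prob_space M \<and> isomorphic_mod_null M (lebesgue_on {0..1::real})"

definition invertible_mpt :: "'a measure \<Rightarrow> ('a \<Rightarrow> 'a) \<Rightarrow> bool" where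
  "invertible_mpt M T \<longleftrightarrow>
     bij_betw T (space M) (space M) \<and> T \<in> M \<rightarrow>\<^sub>M M \<and>
     inv_into (space M) T \<in> M \<rightarrow>\<^sub>M M \<and> distr M M T = M"

text \<open>The integer power of a bijection of \<^term>\<open>space M\<close>; its values outside
  \<^term>\<open>space M\<close> carry no meaning.\<close>

definition int_iterate :: "'a measure \<Rightarrow> ('a \<Rightarrow> 'a) \<Rightarrow> int \<Rightarrow> 'a \<Rightarrow> 'a" where
  "int_iterate M T n =
     (if n \<ge> 0 then T ^^ nat n else inv_into (space M) T ^^ nat (- n))"

definition rigid :: "'a measure \<Rightarrow> ('a \<Rightarrow> 'a) \<Rightarrow> bool" where
  "rigid M T \<longleftrightarrow>
     (\<exists>n :: nat \<Rightarrow> nat. filterlim n at_top sequentially \<and>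
        (\<forall>B\<in>sets M. (\<lambda>k. measure M (sym_diff ((T ^^ n k) ` B) B)) \<longlonglongrightarrow> 0))"

definition weak_mixing :: "'a measure \<Rightarrow> ('a \<Rightarrow> 'a) \<Rightarrow> bool" where
  "weak_mixing M T \<longleftrightarrow>
     (\<forall>B\<in>sets M. \<forall>C\<in>sets M.
        (\<lambda>N. (1 / real N) *
           (\<Sum>n<N. \<bar>measure M ((T ^^ n) ` B \<inter> C) - measure M B * measure M C\<bar>)) \<longlonglongrightarrow> 0)"

end

theory Submission
  imports Defs "HOL-Real_Asymp.Real_Asymp"
begin

text \<open>
  Let \<open>a\<^sub>k = \<Prod>i<k. 2 i + 3\<close>, let \<open>D\<^sub>k\<close> be the set of all sums \<open>\<Sum>i<k. c\<^sub>i a\<^sub>i\<close> with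
  digits \<open>0 \<le> c\<^sub>i \<le> i + 1\<close>, and let \<open>m F\<close> be the decreasing limit of \<open>|F + D\<^sub>k| / |D\<^sub>k|\<close> for
  finite \<open>F \<subseteq> \<int>\<close>. Up to a limit, \<open>exp (- m F)\<close> is the probability that a Poisson scattering of
  translates of \<open>D\<^sub>k\<close> with intensity \<open>1 / |D\<^sub>k|\<close> misses \<open>F\<close>; hence there is a stationary
  \<open>{0,1}\<close>-valued process \<open>X\<close> with \<open>P (X = 1 on F) = exp (- m F)\<close>, and \<open>T\<close> is its shift.

  Everything is read off from \<open>m\<close>. The progression \<open>0, a\<^sub>k, \<dots>, (k + 1) a\<^sub>k\<close> inside \<open>D\<^bsub>k+1\<^esub>\<close>
  makes \<open>a\<^sub>k\<close> a rigidity sequence. The residues modulo \<open>a\<^sub>j\<close> of every \<open>D\<^sub>k\<close> with \<open>k \<ge> j\<close> lie in \<open>D\<^sub>j\<close>,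
  and \<open>|D\<^sub>j| / a\<^sub>j \<le> (2/3)\<^sup>j\<close>, so on average \<open>m ((F + n) \<union> G)\<close> is close to \<open>m F + m G\<close>; this is weak
  mixing. Finally \<open>D\<^sub>k - D\<^sub>k\<close> exhausts \<open>\<int>\<close> (balanced mixed-radix expansions), so
  \<open>m {0, n} < 2 = 2 m {0}\<close> for every \<open>n\<close>, and the event \<open>X\<^sub>0 = 1\<close> is the desired set.
\<close>

section \<open>The hitting capacity of the digit sets\<close>

definition radix :: "nat \<Rightarrow> int" where
  "radix k = (\<Prod>i<k. 2 * int i + 3)"

definition nwords :: "nat \<Rightarrow> nat" where
  "nwords k = (\<Prod>i<k. i + 2)"

fun digit_set :: "nat \<Rightarrow> int set" where
  "digit_set 0 = {0}"
| "digit_set (Suc k) = (\<Union>c\<in>{0..int k + 1}. (\<lambda>d. d + c * radix k) ` digit_set k)"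

definition sumset :: "nat \<Rightarrow> int set \<Rightarrow> int set" where
  "sumset k F = (\<Union>x\<in>F. (+) x ` digit_set k)"

definition capacity :: "nat \<Rightarrow> int set \<Rightarrow> real" where
  "capacity k F = real (card (sumset k F)) / real (nwords k)"

lemma radix_0 [simp]: "radix 0 = 1"
  and radix_Suc: "radix (Suc k) = (2 * int k + 3) * radix k"
  by (simp_all add: radix_def)

lemma nwords_0 [simp]: "nwords 0 = 1"
  and nwords_Suc: "nwords (Suc k) = (k + 2) * nwords k"
  by (simp_all add: nwords_def)

lemma real_nwords_Suc: "real (nwords (Suc k)) = (real k + 2) * real (nwords k)"
  by (simp add: nwords_Suc algebra_simps)

lemma radix_pos [simp]: "radix k > 0"
  by (induction k) (simp_all add: radix_Suc)

lemma radix_nonneg [simp]: "radix k \<ge> 0"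
  using radix_pos[of k] by linarith

lemma nwords_pos [simp]: "nwords k > 0"
  by (induction k) (simp_all add: nwords_Suc)

lemma radix_dvd: "j \<le> k \<Longrightarrow> radix j dvd radix k"
  unfolding radix_def by (rule prod_dvd_prod_subset) auto

lemma radix_unbounded: "int k < radix k"
proof (induction k)
  case (Suc k)
  have "int (Suc k) < 3 * radix k" using Suc radix_pos[of k] by linarith
  also have "\<dots> \<le> radix (Suc k)"
    unfolding radix_Suc by (rule mult_right_mono) (use radix_pos[of k] in auto)
  finally show ?case .
qed simp

lemma finite_digit_set [simp]: "finite (digit_set k)"
  by (induction k) auto

lemma digit_set_SucI:
  "d \<in> digit_set k \<Longrightarrow> 0 \<le> c \<Longrightarrow> c \<le> int k + 1 \<Longrightarrow> d + c * radix k \<in> digit_set (Suc k)"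
  by auto

lemma digit_set_bounds: "d \<in> digit_set k \<Longrightarrow> 0 \<le> d \<and> d < radix k"
proof (induction k arbitrary: d)
  case (Suc k)
  then obtain c e where ce: "0 \<le> c" "c \<le> int k + 1" "e \<in> digit_set k" "d = e + c * radix k"
    by auto
  with Suc.IH[of e] have e: "0 \<le> e" "e < radix k" by auto
  have "d < (c + 1) * radix k" using ce e by (simp add: algebra_simps)
  also have "\<dots> \<le> radix (Suc k)"
    unfolding radix_Suc by (rule mult_right_mono) (use ce radix_pos[of k] in auto)
  finally show ?case using ce e radix_pos[of k] by simp
qed simp

text \<open>Expansions are unique: \<open>digit_set_bounds\<close> keeps the lower part below
  \<open>radix k\<close>, so division by \<open>radix k\<close> recovers the leading digit and the
  \<open>k + 2\<close> translates are disjoint.\<close>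

lemma card_digit_set: "card (digit_set k) = nwords k"
proof (induction k)
  case (Suc k)
  have disj: "(\<lambda>d. d + c * radix k) ` digit_set k \<inter> (\<lambda>d. d + c' * radix k) ` digit_set k = {}"
    if "c \<noteq> c'" for c c'
  proof (rule ccontr)
    assume "\<not> ?thesis"
    then obtain d e where de: "d \<in> digit_set k" "e \<in> digit_set k" "d + c * radix k = e + c' * radix k"
      by auto
    have "(d + c * radix k) div radix k = c" "(e + c' * radix k) div radix k = c'"
      using digit_set_bounds[OF de(1)] digit_set_bounds[OF de(2)] radix_pos[of k] by auto
    with de that show False by simp
  qed
  have "card (digit_set (Suc k)) =
      (\<Sum>c\<in>{0..int k + 1}. card ((\<lambda>d. d + c * radix k) ` digit_set k))"
    unfolding digit_set.simps by (rule card_UN_disjoint) (use disj in auto)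
  also have "\<dots> = (\<Sum>c\<in>{0..int k + 1}. nwords k)"
    by (intro sum.cong refl) (subst card_image, auto simp: inj_on_def Suc)
  also have "\<dots> = nwords (Suc k)" by (simp add: nwords_Suc nat_add_distrib)
  finally show ?case .
qed simp

lemma finite_sumset [simp]: "finite F \<Longrightarrow> finite (sumset k F)"
  by (simp add: sumset_def)

lemma sumset_Un: "sumset k (F \<union> G) = sumset k F \<union> sumset k G"
  by (auto simp: sumset_def)

lemma sumset_translate: "sumset k ((+) n ` F) = (+) n ` sumset k F"
  by (auto simp: sumset_def image_iff add.assoc)

lemma sumset_Suc:
  "sumset (Suc k) F = (\<Union>c\<in>{0..int k + 1}. (+) (c * radix k) ` sumset k F)"
  by (fastforce simp: sumset_def image_iff ac_simps)

lemma card_translates_le: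
  assumes "finite (S :: int set)"
  shows "card (\<Union>c\<in>{0..int n}. (+) (c * a) ` S) \<le> (n + 1) * card S"
proof -
  have "card (\<Union>c\<in>{0..int n}. (+) (c * a) ` S) \<le> (\<Sum>c\<in>{0..int n}. card ((+) (c * a) ` S))"
    by (rule card_UN_le) simp
  also have "\<dots> = (n + 1) * card S" by (simp add: card_image nat_add_distrib)
  finally show ?thesis .
qed

text \<open>Passing to the next level makes the sumset a union of \<open>k + 2\<close> translates of
  the previous one, while \<open>nwords\<close> grows by exactly the factor \<open>k + 2\<close>;
  overlaps can only lower the quotient.\<close>

lemma capacity_Suc_le: "finite F \<Longrightarrow> capacity (Suc k) F \<le> capacity k F"
proof -
  assume "finite F"
  then have "card (sumset (Suc k) F) \<le> (k + 2) * card (sumset k F)"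
    using card_translates_le[of "sumset k F" "radix k" "k + 1"] by (simp add: sumset_Suc add.commute)
  then have "real (card (sumset (Suc k) F)) \<le> (real k + 2) * real (card (sumset k F))"
    by (metis (mono_tags) of_nat_add of_nat_mono of_nat_mult of_nat_numeral)
  then have "capacity (Suc k) F \<le> (real k + 2) * real (card (sumset k F)) / real (nwords (Suc k))"
    unfolding capacity_def by (rule divide_right_mono) simp
  also have "\<dots> = capacity k F"
    unfolding capacity_def real_nwords_Suc by simp
  finally show ?thesis .
qed

lemma capacity_nonneg: "0 \<le> capacity k F"
  by (simp add: capacity_def)

section \<open>The limiting capacity and its values on small sets\<close>

definition lim_capacity :: "int set \<Rightarrow> real" where
  "lim_capacity F = lim (\<lambda>k. capacity k F)"

lemma capacity_tendsto: "finite F \<Longrightarrow> (\<lambda>k. capacity k F) \<longlonglongrightarrow> lim_capacity F"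
proof -
  assume "finite F"
  then have "decseq (\<lambda>k. capacity k F)" by (auto intro: decseq_SucI capacity_Suc_le)
  then obtain L where "(\<lambda>k. capacity k F) \<longlonglongrightarrow> L"
    using decseq_convergent[of "\<lambda>k. capacity k F" 0] capacity_nonneg by (metis (no_types))
  then show ?thesis by (simp add: lim_capacity_def limI)
qed

lemma lim_capacity_le: "finite F \<Longrightarrow> lim_capacity F \<le> capacity k F"
  by (rule decseq_ge[OF _ capacity_tendsto]) (auto intro: decseq_SucI capacity_Suc_le)

lemma lim_capacity_nonneg: "finite F \<Longrightarrow> 0 \<le> lim_capacity F"
  by (rule LIMSEQ_le_const[OF capacity_tendsto]) (auto simp: capacity_nonneg)

lemma capacity_translate: "capacity k ((+) n ` F) = capacity k F"
  by (simp add: capacity_def sumset_translate card_image)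

lemma lim_capacity_translate: "lim_capacity ((+) n ` F) = lim_capacity F"
  by (simp add: lim_capacity_def capacity_translate)

lemma lim_capacity_empty: "lim_capacity {} = 0"
  by (simp add: lim_capacity_def capacity_def sumset_def)

lemma sumset_zero: "sumset k {0} = digit_set k"
  by (simp add: sumset_def)

lemma lim_capacity_zero: "lim_capacity {0} = 1"
  using nwords_pos by (simp add: lim_capacity_def capacity_def sumset_zero card_digit_set less_imp_neq[symmetric])

text \<open>These differences are the balanced expansions in the odd radices \<open>2 k + 3\<close>, with digits
  between \<open>-(k+1)\<close> and \<open>k + 1\<close>.\<close>

lemma digit_set_differences:
  "2 * \<bar>n\<bar> < radix k \<Longrightarrow> \<exists>d\<in>digit_set k. \<exists>e\<in>digit_set k. n = d - e"
proof (induction k arbitrary: n)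
  case (Suc k)
  define a where "a = radix k"
  have a: "a > 0" "odd a"
    by (auto simp: a_def) (simp add: radix_def even_prod_iff)
  \<comment> \<open>\<open>c\<close> is \<open>n / a\<close> rounded to the nearest integer, which
    leaves a remainder \<open>s\<close> of absolute value at most \<open>a / 2\<close>; equality is
    excluded because \<open>a\<close> is odd.\<close>
  define c where "c = (2 * n + a) div (2 * a)"
  define s where "s = n - c * a"
  have "2 * a * c + (2 * n + a) mod (2 * a) = 2 * n + a"
    unfolding c_def by (simp add: mult_div_mod_eq)
  moreover have "0 \<le> (2 * n + a) mod (2 * a)" "(2 * n + a) mod (2 * a) < 2 * a"
    using a by simp_all
  ultimately have s: "- a \<le> 2 * s" "2 * s < a"
    by (auto simp: s_def algebra_simps)
  moreover have "2 * s \<noteq> - a" using a by presburger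
  ultimately have s': "2 * \<bar>s\<bar> < radix k" by (auto simp: a_def)
  then obtain d e where de: "d \<in> digit_set k" "e \<in> digit_set k" "s = d - e"
    using Suc.IH by blast
  have ca: "c * a = n - s" by (simp add: s_def)
  have "2 * \<bar>c * a\<bar> \<le> 2 * \<bar>n\<bar> + 2 * \<bar>s\<bar>" unfolding ca using abs_triangle_ineq4[of n s] by simp
  also have "\<dots> < (2 * int k + 3) * a + a"
    using Suc.prems s' by (simp add: radix_Suc a_def)
  also have "\<dots> = 2 * ((int k + 2) * a)" by (simp add: algebra_simps)
  finally have "\<bar>c\<bar> * a < (int k + 2) * a" using a by (simp add: abs_mult)
  then have c: "\<bar>c\<bar> \<le> int k + 1" using a by simp
  \<comment> \<open>The signed digit \<open>c\<close> becomes a difference of two admissible digits,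
    at least one of them zero.\<close>
  have n: "n = (d + max c 0 * a) - (e + max (-c) 0 * a)"
    using de(3) by (cases "c \<ge> 0") (simp_all add: s_def)
  have "d + max c 0 * a \<in> digit_set (Suc k)" "e + max (-c) 0 * a \<in> digit_set (Suc k)"
    unfolding a_def using c
    by (auto intro!: digit_set_SucI[OF de(1)] digit_set_SucI[OF de(2)] simp del: digit_set.simps)
  with n show ?case by blast
qed simp

text \<open>Strictness arises at a finite level: as soon as \<open>n\<close> is a difference of two
  elements of \<open>digit_set k\<close>, this set meets its translate by \<open>n\<close>. Since
  capacities decrease in \<open>k\<close>, the loss survives in the limit.\<close>

lemma lim_capacity_pair: "lim_capacity {0, n} < 2"
proof -
  define k where "k = nat (2 * \<bar>n\<bar>)"
  have "2 * \<bar>n\<bar> < radix k" using radix_unbounded[of k] by (simp add: k_def)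
  then obtain d e where de: "d \<in> digit_set k" "e \<in> digit_set k" "n = d - e"
    using digit_set_differences by blast
  have eq: "sumset k {0, n} = digit_set k \<union> (+) n ` digit_set k"
    by (auto simp: sumset_def)
  have "d \<in> digit_set k \<inter> (+) n ` digit_set k" using de by (auto simp: image_iff)
  then have "card (digit_set k \<inter> (+) n ` digit_set k) > 0" by (auto simp: card_gt_0_iff)
  moreover have "card (digit_set k) + card ((+) n ` digit_set k) =
      card (sumset k {0, n}) + card (digit_set k \<inter> (+) n ` digit_set k)"
    unfolding eq by (rule card_Un_Int) auto
  ultimately have "card (sumset k {0, n}) < 2 * nwords k"
    by (simp add: card_image card_digit_set)
  then have "real (card (sumset k {0, n})) < 2 * real (nwords k)" by linarith
  then have "capacity k {0, n} < 2" by (simp add: capacity_def divide_less_eq)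
  with lim_capacity_le[of "{0, n}" k] show ?thesis by simp
qed

text \<open>At level \<open>k + 1\<close> the sumset of \<open>F\<close> consists of
  \<open>k + 2\<close> translates of \<open>sumset k F\<close>, in arithmetic progression with
  difference \<open>radix k\<close>. Adjoining the shift by \<open>radix k\<close> adds one more
  term, so the capacity of the union is at most \<open>(k + 3) / (k + 2)\<close> times
  \<open>capacity k F\<close>.\<close>

lemma lim_capacity_rigid:
  assumes "finite F"
  shows "(\<lambda>k. lim_capacity ((+) (radix k) ` F \<union> F)) \<longlonglongrightarrow> lim_capacity F"
proof (rule tendsto_sandwich)
  have "card (sumset k F) \<le> card (sumset k ((+) n ` F \<union> F))" for k n
    using assms by (intro card_mono) (auto simp: sumset_Un)
  then have "capacity k F \<le> capacity k ((+) n ` F \<union> F)" for k n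
    by (simp add: capacity_def divide_right_mono)
  then show "\<forall>\<^sub>F k in sequentially. lim_capacity F \<le> lim_capacity ((+) (radix k) ` F \<union> F)"
    using assms by (intro always_eventually allI LIMSEQ_le[OF capacity_tendsto capacity_tendsto]) auto
  have "lim_capacity ((+) (radix k) ` F \<union> F) \<le> (1 + 1 / (real k + 2)) * capacity k F" for k
  proof -
    have "sumset (Suc k) ((+) (radix k) ` F \<union> F) \<subseteq>
        (\<Union>c\<in>{0..int (k + 2)}. (+) (c * radix k) ` sumset k F)"
    proof -
      have "(+) (radix k) ` (+) (c * radix k) ` S = (+) ((c + 1) * radix k) ` S" for c S
        by (simp add: image_image algebra_simps)
      then have "sumset (Suc k) ((+) (radix k) ` F \<union> F) =
          (\<Union>c\<in>{0..int k + 1}. (+) ((c + 1) * radix k) ` sumset k F) \<union>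
          (\<Union>c\<in>{0..int k + 1}. (+) (c * radix k) ` sumset k F)"
        by (simp only: sumset_Un sumset_translate) (simp only: sumset_Suc image_UN)
      also have "\<dots> \<subseteq> (\<Union>c\<in>{0..int (k + 2)}. (+) (c * radix k) ` sumset k F)"
      proof (intro Un_least UN_least)
        fix c assume "c \<in> {0..int k + 1}"
        then show "(+) ((c + 1) * radix k) ` sumset k F \<subseteq> (\<Union>c\<in>{0..int (k + 2)}. (+) (c * radix k) ` sumset k F)"
          by (intro UN_upper[of "c + 1" _ "\<lambda>c. (+) (c * radix k) ` sumset k F"]) auto
      next
        fix c assume "c \<in> {0..int k + 1}"
        then show "(+) (c * radix k) ` sumset k F \<subseteq> (\<Union>c\<in>{0..int (k + 2)}. (+) (c * radix k) ` sumset k F)"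
          by (intro UN_upper[of c _ "\<lambda>c. (+) (c * radix k) ` sumset k F"]) auto
      qed
      finally show ?thesis .
    qed
    then have "card (sumset (Suc k) ((+) (radix k) ` F \<union> F)) \<le>
        card (\<Union>c\<in>{0..int (k + 2)}. (+) (c * radix k) ` sumset k F)"
      using assms by (intro card_mono) auto
    also have "\<dots> \<le> (k + 2 + 1) * card (sumset k F)"
      by (rule card_translates_le) (use assms in auto)
    finally have "real (card (sumset (Suc k) ((+) (radix k) ` F \<union> F))) \<le>
        real ((k + 2 + 1) * card (sumset k F))" by (rule of_nat_mono)
    then have "capacity (Suc k) ((+) (radix k) ` F \<union> F) \<le> 
       real ((k + 2 + 1) * card (sumset k F)) / real (nwords (Suc k))"
      unfolding capacity_def by (rule divide_right_mono) simp
    also have "\<dots> = (1 + 1 / (real k + 2)) * capacity k F"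
      unfolding capacity_def real_nwords_Suc by (simp add: divide_simps) (simp add: algebra_simps)
    finally show ?thesis
      using lim_capacity_le[of "(+) (radix k) ` F \<union> F" "Suc k"] assms by simp
  qed
  then show "\<forall>\<^sub>F k in sequentially. lim_capacity ((+) (radix k) ` F \<union> F) \<le> (1 + 1 / (real k + 2)) * capacity k F"
    by simp
  have "(\<lambda>k. 1 / (real k + 2)) \<longlonglongrightarrow> 0" by real_asymp
  from tendsto_mult[OF tendsto_add[OF tendsto_const[of 1] this] capacity_tendsto[OF assms]]
  show "(\<lambda>k. (1 + 1 / (real k + 2)) * capacity k F) \<longlonglongrightarrow> lim_capacity F" by simp
qed simp


section \<open>Sparseness of the digit sets and averaged overlaps\<close>

lemma digit_set_mod: "j \<le> k \<Longrightarrow> d \<in> digit_set k \<Longrightarrow> d mod radix j \<in> digit_set j"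
proof (induction k arbitrary: d rule: dec_induct)
  case base
  then show ?case using digit_set_bounds[of d j] by simp
next
  case (step k)
  then obtain c e where ce: "e \<in> digit_set k" "d = e + c * radix k" by auto
  have "radix j dvd c * radix k" using radix_dvd[of j k] step by simp
  then have "d mod radix j = e mod radix j"
    unfolding ce by (metis add.right_neutral dvd_imp_mod_0 mod_add_right_eq)
  with step.IH[OF ce(1)] show ?case by simp
qed

text \<open>Reduction modulo \<open>radix j\<close> is injective on a window of length
  \<open>radix j\<close>, and by \<open>digit_set_mod\<close> it sends \<open>digit_set k\<close>
  into \<open>digit_set j\<close>. Thus at scale \<open>radix j\<close> every later digit set has
  density at most \<open>nwords j / radix j\<close>.\<close>

lemma card_digit_set_window:
  assumes "j \<le> k"
  shows "card (digit_set k \<inter> {x..<x + radix j}) \<le> nwords j"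
proof -
  have "inj_on (\<lambda>d. d mod radix j) {x..<x + radix j}"
  proof (rule inj_onI)
    fix d e assume de: "d \<in> {x..<x + radix j}" "e \<in> {x..<x + radix j}" "d mod radix j = e mod radix j"
    then have "radix j dvd d - e" by (simp add: mod_eq_dvd_iff)
    moreover have "\<bar>d - e\<bar> < radix j" using de by auto
    ultimately show "d = e" using dvd_imp_le_int[of "d - e" "radix j"] by force
  qed
  then have "card (digit_set k \<inter> {x..<x + radix j}) \<le> card (digit_set j)"
    using digit_set_mod[OF assms] by (intro card_inj_on_le[of "\<lambda>d. d mod radix j"]) (auto intro: inj_on_subset)
  then show ?thesis by (simp add: card_digit_set)
qed

lemma card_digit_set_long_window:
  assumes "j \<le> k"
  shows "card (digit_set k \<inter> {x..<x + int q * radix j}) \<le> q * nwords j"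
proof (induction q)
  case (Suc q)
  have "{x..<x + int (Suc q) * radix j} =
      {x..<x + int q * radix j} \<union> {x + int q * radix j..<x + int q * radix j + radix j}"
    by (subst ivl_disj_un_two(3)) (auto simp: algebra_simps)
  then have "card (digit_set k \<inter> {x..<x + int (Suc q) * radix j}) \<le>
      card (digit_set k \<inter> {x..<x + int q * radix j}) +
      card (digit_set k \<inter> {x + int q * radix j..<x + int q * radix j + radix j})"
    by (simp add: Int_Un_distrib card_Un_le)
  also have "\<dots> \<le> q * nwords j + nwords j"
    using Suc card_digit_set_window[OF assms] by (rule add_mono)
  finally show ?case by simp
qed simp

text \<open>Double counting of pairs: for fixed \<open>d\<close> the points \<open>d - s - n\<close>
  with \<open>n < N\<close> are distinct and lie in one long window, where
  \<open>card_digit_set_long_window\<close> bounds how many belong to the digit set.\<close>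

lemma sum_card_digit_set_overlap:
  assumes "j \<le> k"
  shows "(\<Sum>n<N. card (digit_set k \<inter> (+) (int n + s) ` digit_set k))
      \<le> nwords k * ((N div nat (radix j) + 1) * nwords j)"
proof -
  define q where "q = N div nat (radix j) + 1"
  have "int N \<le> int q * radix j"
  proof -
    have "N < q * nat (radix j)" unfolding q_def
      using radix_pos[of j] by (metis add.commute dividend_less_div_times mult.commute mult_Suc_right plus_1_eq_Suc zero_less_nat_eq)
    then have "int N < int (q * nat (radix j))" by (simp only: of_nat_less_iff)
    then show ?thesis by simp
  qed
  note N = this
  let ?D = "digit_set k"
  have "(\<Sum>n<N. card (?D \<inter> (+) (int n + s) ` ?D)) = (\<Sum>n<N. \<Sum>d\<in>?D. if d - s - int n \<in> ?D then 1 else 0)"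
  proof (rule sum.cong[OF refl])
    fix n
    have "?D \<inter> (+) (int n + s) ` ?D = {d \<in> ?D. d - s - int n \<in> ?D}"
      by (auto simp: image_iff algebra_simps) (metis add.commute add.left_commute diff_add_cancel diff_diff_add)+
    then show "card (?D \<inter> (+) (int n + s) ` ?D) = (\<Sum>d\<in>?D. if d - s - int n \<in> ?D then 1 else 0)"
      by (simp add: sum.If_cases Int_def)
  qed
  also have "\<dots> = (\<Sum>d\<in>?D. \<Sum>n<N. if d - s - int n \<in> ?D then 1 else 0)" by (rule sum.swap)
  also have "\<dots> \<le> (\<Sum>d\<in>?D. q * nwords j)"
  proof (rule sum_mono)
    fix d
    \<comment> \<open>The \<open>+ 1\<close> makes the half-open window end at \<open>d - s\<close>,
      the point for \<open>n = 0\<close>; its length \<open>q * radix j\<close> is at least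
      \<open>N\<close>, so the points for all other \<open>n < N\<close> are inside as well.\<close>
    let ?x = "d - s - int q * radix j + 1"
    have "(\<Sum>n<N. if d - s - int n \<in> ?D then 1 else 0) = card {n. n < N \<and> d - s - int n \<in> ?D}"
      by (simp add: sum.If_cases Int_def lessThan_def)
    also have "\<dots> \<le> card (?D \<inter> {?x..<?x + int q * radix j})"
      using N by (intro card_inj_on_le[of "\<lambda>n. d - s - int n"]) (auto simp: inj_on_def)
    also have "\<dots> \<le> q * nwords j" by (rule card_digit_set_long_window[OF assms])
    finally show "(\<Sum>n<N. if d - s - int n \<in> ?D then 1 else 0) \<le> q * nwords j" .
  qed
  finally show ?thesis by (simp add: card_digit_set q_def)
qed

text \<open>By inclusion-exclusion the failure of additivity is the normalised size of the
  intersection of two sumsets. A common point \<open>n + f + d = g + e\<close> puts \<open>e\<close>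
  into the overlap of the digit set with its translate by \<open>n + (f - g)\<close>.\<close>

lemma capacity_defect:
  assumes "finite F" "finite G"
  shows "\<bar>capacity k F + capacity k G - capacity k ((+) n ` F \<union> G)\<bar> \<le>
    (\<Sum>f\<in>F. \<Sum>g\<in>G. real (card (digit_set k \<inter> (+) (n + (f - g)) ` digit_set k))) / real (nwords k)"
proof -
  let ?D = "digit_set k"
  let ?S = "sumset k ((+) n ` F)" and ?T = "sumset k G"
  have "card ?S + card ?T = card (?S \<union> ?T) + card (?S \<inter> ?T)"
    using assms by (intro card_Un_Int) auto
  then have "real (card ?S) + real (card ?T) = real (card (?S \<union> ?T)) + real (card (?S \<inter> ?T))"
    by linarith
  then have eq: "capacity k F + capacity k G - capacity k ((+) n ` F \<union> G) = real (card (?S \<inter> ?T)) / real (nwords k)"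
    unfolding capacity_translate[of k n F, symmetric]
    by (simp add: capacity_def sumset_Un field_simps flip: add_divide_distrib diff_divide_distrib)
  have sub: "?S \<inter> ?T \<subseteq> (\<Union>f\<in>F. \<Union>g\<in>G. (+) g ` (?D \<inter> (+) (n + (f - g)) ` ?D))"
  proof
    fix z assume "z \<in> ?S \<inter> ?T"
    then obtain f g d e where *: "f \<in> F" "g \<in> G" "d \<in> ?D" "e \<in> ?D" "z = n + f + d" "z = g + e"
      by (auto simp: sumset_def)
    then have "e = (n + (f - g)) + d" by simp
    with * show "z \<in> (\<Union>f\<in>F. \<Union>g\<in>G. (+) g ` (?D \<inter> (+) (n + (f - g)) ` ?D))" by blast
  qed
  have "card (?S \<inter> ?T) \<le> card (\<Union>f\<in>F. \<Union>g\<in>G. (+) g ` (?D \<inter> (+) (n + (f - g)) ` ?D))"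
    by (rule card_mono[OF _ sub]) (use assms in auto)
  also have "\<dots> \<le> (\<Sum>f\<in>F. card (\<Union>g\<in>G. (+) g ` (?D \<inter> (+) (n + (f - g)) ` ?D)))"
    by (rule card_UN_le[OF assms(1)])
  also have "\<dots> \<le> (\<Sum>f\<in>F. \<Sum>g\<in>G. card ((+) g ` (?D \<inter> (+) (n + (f - g)) ` ?D)))"
    by (intro sum_mono card_UN_le assms)
  also have "\<dots> = (\<Sum>f\<in>F. \<Sum>g\<in>G. card (?D \<inter> (+) (n + (f - g)) ` ?D))"
    by (simp add: card_image)
  finally have "real (card (?S \<inter> ?T)) \<le> (\<Sum>f\<in>F. \<Sum>g\<in>G. real (card (?D \<inter> (+) (n + (f - g)) ` ?D)))"
    by (metis (no_types, lifting) of_nat_mono of_nat_sum sum.cong)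
  then show ?thesis unfolding eq by (simp add: divide_right_mono)
qed

text \<open>Summing over \<open>n\<close> produces a bound free of \<open>k\<close>, which therefore
  passes to the limiting capacity with the auxiliary level \<open>j\<close> still at choice.\<close>

lemma sum_capacity_defect:
  assumes "finite F" "finite G" "j \<le> k"
  shows "(\<Sum>n<N. \<bar>capacity k F + capacity k G - capacity k ((+) (int n) ` F \<union> G)\<bar>) \<le>
    real (card F * card G) * ((real N / radix j + 1) * real (nwords j))"
proof -
  let ?D = "digit_set k"
  have "(\<Sum>n<N. \<bar>capacity k F + capacity k G - capacity k ((+) (int n) ` F \<union> G)\<bar>) \<le>
     (\<Sum>n<N. (\<Sum>f\<in>F. \<Sum>g\<in>G. real (card (?D \<inter> (+) (int n + (f - g)) ` ?D))) / real (nwords k))"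
    by (intro sum_mono capacity_defect assms)
  also have "\<dots> = (\<Sum>n<N. \<Sum>f\<in>F. \<Sum>g\<in>G. real (card (?D \<inter> (+) (int n + (f - g)) ` ?D))) / real (nwords k)"
    by (simp add: sum_divide_distrib)
  also have "(\<Sum>n<N. \<Sum>f\<in>F. \<Sum>g\<in>G. real (card (?D \<inter> (+) (int n + (f - g)) ` ?D))) =
     (\<Sum>f\<in>F. \<Sum>g\<in>G. \<Sum>n<N. real (card (?D \<inter> (+) (int n + (f - g)) ` ?D)))"
    by (subst sum.swap, rule sum.cong[OF refl], rule sum.swap)
  also have "\<dots> \<le> (\<Sum>f\<in>F. \<Sum>g\<in>G. real (nwords k * ((N div nat (radix j) + 1) * nwords j)))"
    unfolding of_nat_sum[symmetric]
    by (intro sum_mono of_nat_mono sum_card_digit_set_overlap assms)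
  also have "\<dots> / real (nwords k) = real (card F * card G) * (real (N div nat (radix j) + 1) * real (nwords j))"
    using nwords_pos[of k] by (simp del: nwords_pos) (simp add: algebra_simps)
  also have "\<dots> \<le> real (card F * card G) * ((real N / radix j + 1) * real (nwords j))"
  proof (intro mult_left_mono mult_right_mono)
    have "real (N div nat (radix j)) \<le> real N / real (nat (radix j))" by (rule of_nat_div_le_of_nat)
    then show "real (N div nat (radix j) + 1) \<le> real N / radix j + 1" by simp
  qed auto
  finally show ?thesis by (simp add: divide_right_mono)
qed

lemma sum_lim_capacity_defect:
  assumes "finite F" "finite G"
  shows "(\<Sum>n<N. \<bar>lim_capacity F + lim_capacity G - lim_capacity ((+) (int n) ` F \<union> G)\<bar>) \<le>
    real (card F * card G) * ((real N / radix j + 1) * real (nwords j))"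
proof (rule LIMSEQ_le_const2)
  show "(\<lambda>k. \<Sum>n<N. \<bar>capacity k F + capacity k G - capacity k ((+) (int n) ` F \<union> G)\<bar>) \<longlonglongrightarrow>
    (\<Sum>n<N. \<bar>lim_capacity F + lim_capacity G - lim_capacity ((+) (int n) ` F \<union> G)\<bar>)"
    using assms by (intro tendsto_intros capacity_tendsto) auto
qed (use sum_capacity_defect[OF assms] in auto)

lemma nwords_radix_ratio: "real (nwords j) / radix j \<le> (2 / 3) ^ j"
proof (induction j)
  case (Suc j)
  have "real (nwords (Suc j)) / radix (Suc j) = (real j + 2) / (2 * real j + 3) * (real (nwords j) / radix j)"
    by (simp add: real_nwords_Suc radix_Suc)
  also have "\<dots> \<le> (2 / 3) * (2 / 3) ^ j"
    using Suc by (intro mult_mono) (auto simp: divide_simps)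
  finally show ?case by simp
qed simp

lemma cesaro_lim_capacity:
  assumes "finite F" "finite G"
  shows "(\<lambda>N. 1 / real N * (\<Sum>n<N. \<bar>lim_capacity F + lim_capacity G - lim_capacity ((+) (int n) ` F \<union> G)\<bar>)) \<longlonglongrightarrow> 0"
    (is "?c \<longlonglongrightarrow> 0")
proof (rule LIMSEQ_I)
  fix e :: real assume e: "e > 0"
  define C where "C = real (card F * card G)"
  have C: "C \<ge> 0" by (simp add: C_def)
  \<comment> \<open>First \<open>j\<close> is fixed so that the density term
    \<open>C * nwords j / radix j\<close> is small; only afterwards is \<open>N\<close> taken large,
    to absorb the boundary term \<open>C * nwords j / N\<close>.\<close>
  have "(\<lambda>j. C * (2 / 3) ^ j) \<longlonglongrightarrow> C * 0"
    by (intro tendsto_intros LIMSEQ_power_zero) auto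
  then have "\<forall>\<^sub>F j in sequentially. C * (2 / 3) ^ j < e / 2"
    by (rule order_tendstoD) (use e in auto)
  then obtain j where j: "C * (2 / 3) ^ j < e / 2" by (auto simp: eventually_sequentially)
  have "(\<lambda>N. C * real (nwords j) / real N) \<longlonglongrightarrow> 0" by (rule lim_const_over_n)
  then have "\<forall>\<^sub>F N in sequentially. C * real (nwords j) / real N < e / 2"
    by (rule order_tendstoD) (use e in auto)
  then obtain N0 where N0: "\<And>N. N \<ge> N0 \<Longrightarrow> C * real (nwords j) / real N < e / 2"
    by (auto simp: eventually_sequentially)
  show "\<exists>N0. \<forall>N\<ge>N0. norm (?c N - 0) < e"
  proof (intro exI allI impI)
    fix N assume N: "N \<ge> max N0 1"
    have "?c N \<le> 1 / real N * (C * ((real N / radix j + 1) * real (nwords j)))"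
      unfolding C_def by (intro mult_left_mono sum_lim_capacity_defect assms) auto
    also have "\<dots> = C * (real (nwords j) / radix j) + C * real (nwords j) / real N"
      using N radix_pos[of j] by (simp add: field_simps)
    also have "\<dots> < e / 2 + e / 2"
    proof (rule add_strict_mono)
      show "C * (real (nwords j) / radix j) < e / 2"
        using mult_left_mono[OF nwords_radix_ratio[of j] C] j by (rule order.strict_trans1)
      show "C * real (nwords j) / real N < e / 2" using N0 N by simp
    qed
    finally have "?c N < e" by simp
    moreover have "?c N \<ge> 0" by (intro mult_nonneg_nonneg sum_nonneg) auto
    ultimately show "norm (?c N - 0) < e" by simp
  qed
qed

section \<open>Complete monotonicity\<close>

text \<open>If \<open>\<phi> F\<close> is the probability that a \<open>{0,1}\<close>-valued process is \<open>1\<close> on \<open>F\<close>, then \<open>alt \<phi> F gs\<close>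
  is the probability that it is \<open>1\<close> on \<open>F\<close> and \<open>0\<close> on \<open>gs\<close>.\<close>

primrec alt :: "('i set \<Rightarrow> real) \<Rightarrow> 'i set \<Rightarrow> 'i list \<Rightarrow> real" where
  "alt \<phi> F [] = \<phi> F"
| "alt \<phi> F (g # gs) = alt \<phi> F gs - alt \<phi> (insert g F) gs"

text \<open>These sums are the prospective cylinder probabilities. Their consistency is the
  recursion of \<open>alt\<close> itself, so nonnegativity, with value 1 at the empty set, is all
  that a process requires.\<close>

definition completely_monotone :: "('i set \<Rightarrow> real) \<Rightarrow> bool" where
  "completely_monotone \<phi> \<longleftrightarrow> (\<forall>F gs. finite F \<longrightarrow> 0 \<le> alt \<phi> F gs)"

lemma completely_monotoneD: "completely_monotone \<phi> \<Longrightarrow> finite F \<Longrightarrow> 0 \<le> alt \<phi> F gs"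
  by (simp add: completely_monotone_def)

lemma alt_add: "alt (\<lambda>F. \<phi> F + \<psi> F) F gs = alt \<phi> F gs + alt \<psi> F gs"
  by (induction gs arbitrary: F) auto

lemma alt_diff: "alt (\<lambda>F. \<phi> F - \<psi> F) F gs = alt \<phi> F gs - alt \<psi> F gs"
  by (induction gs arbitrary: F) auto

lemma alt_insert: "alt (\<lambda>F. \<phi> (insert g F)) F gs = alt \<phi> (insert g F) gs"
  by (induction gs arbitrary: F) (auto simp: insert_commute)

text \<open>Moves a difference from the set argument to the functional, so that an induction over
  the list can change the functional and keep \<open>F\<close> fixed.\<close>

lemma alt_Cons: "alt \<phi> F (g # gs) = alt (\<lambda>F. \<phi> F - \<phi> (insert g F)) F gs"
  by (simp add: alt_diff alt_insert)

lemma completely_monotone_insert: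
  "completely_monotone \<phi> \<Longrightarrow> completely_monotone (\<lambda>F. \<phi> (insert g F))"
  by (auto simp: completely_monotone_def alt_insert)

lemma completely_monotone_diff:
  "completely_monotone \<phi> \<Longrightarrow> completely_monotone (\<lambda>F. \<phi> F - \<phi> (insert g F))"
  by (auto simp: completely_monotone_def alt_Cons[symmetric] simp del: alt.simps)

text \<open>A discrete Leibniz rule splits the difference of a product into two products whose
  factors are again completely monotone. In terms of processes, the product belongs to the
  intersection of two independent random sets.\<close>

lemma completely_monotone_mult:
  assumes "completely_monotone \<phi>" "completely_monotone \<psi>"
  shows "completely_monotone (\<lambda>F. \<phi> F * \<psi> F)"
  unfolding completely_monotone_def
proof (intro allI impI)
  fix F :: "'a set" and gs assume "finite F"
  with assms show "0 \<le> alt (\<lambda>F. \<phi> F * \<psi> F) F gs"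
  proof (induction gs arbitrary: \<phi> \<psi>)
    case Nil
    then show ?case
      using completely_monotoneD[of \<phi> F "[]"] completely_monotoneD[of \<psi> F "[]"] by simp
  next
    case (Cons g gs)
    have "(\<lambda>F. \<phi> F * \<psi> F - \<phi> (insert g F) * \<psi> (insert g F)) =
       (\<lambda>F. (\<phi> F - \<phi> (insert g F)) * \<psi> F + \<phi> (insert g F) * (\<psi> F - \<psi> (insert g F)))"
      by (simp add: algebra_simps)
    then have "alt (\<lambda>F. \<phi> F * \<psi> F) F (g # gs) =
       alt (\<lambda>F. (\<phi> F - \<phi> (insert g F)) * \<psi> F) F gs + alt (\<lambda>F. \<phi> (insert g F) * (\<psi> F - \<psi> (insert g F))) F gs"
      unfolding alt_Cons by (simp add: alt_add)
    moreover have "0 \<le> alt (\<lambda>F. (\<phi> F - \<phi> (insert g F)) * \<psi> F) F gs"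
      by (rule Cons.IH[OF completely_monotone_diff]) (use Cons.prems in auto)
    moreover have "0 \<le> alt (\<lambda>F. \<phi> (insert g F) * (\<psi> F - \<psi> (insert g F))) F gs"
      by (rule Cons.IH[OF completely_monotone_insert completely_monotone_diff]) (use Cons.prems in auto)
    ultimately show ?case by simp
  qed
qed

text \<open>The value at \<open>F\<close> is the probability that \<open>F\<close> lies in a random
  set which is everything with probability \<open>q\<close> and the complement of \<open>B\<close>
  otherwise; the explicit form of \<open>alt\<close> in the proof lists its cylinder
  probabilities.\<close>

lemma completely_monotone_hit:
  assumes "0 \<le> q" "q \<le> 1"
  shows "completely_monotone (\<lambda>F. if F \<inter> B = {} then 1 else q)"
proof -
  have "alt (\<lambda>F. if F \<inter> B = {} then 1 else q) F gs =
     (if gs = [] then q else 0) + (if F \<inter> B = {} \<and> set gs \<subseteq> B then 1 - q else 0)" for F gs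
    by (induction gs arbitrary: F) auto
  with assms show ?thesis by (simp add: completely_monotone_def)
qed

lemma completely_monotone_prod:
  assumes "finite T" "\<And>t. t \<in> T \<Longrightarrow> completely_monotone (\<phi> t)"
  shows "completely_monotone (\<lambda>F. \<Prod>t\<in>T. \<phi> t F)"
  using assms
proof (induction T rule: finite_induct)
  case empty
  then show ?case using completely_monotone_hit[of 1 "{}"] by simp
next
  case (insert t T)
  then show ?case using completely_monotone_mult[of "\<phi> t"] by simp
qed

text \<open>\<open>alt\<close> looks only at sets between \<open>F\<close> and
  \<open>F \<union> set gs\<close>; this permits a product over finitely many translates to stand in
  for the exponential of the capacity.\<close>

lemma alt_cong:
  "(\<And>H. F \<subseteq> H \<Longrightarrow> H \<subseteq> F \<union> set gs \<Longrightarrow> \<phi> H = \<psi> H) \<Longrightarrow> alt \<phi> F gs = alt \<psi> F gs"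
proof (induction gs arbitrary: F)
  case (Cons g gs)
  have "alt \<phi> F gs = alt \<psi> F gs" "alt \<phi> (insert g F) gs = alt \<psi> (insert g F) gs"
    by (rule Cons.IH, rule Cons.prems; auto)+
  then show ?case by simp
qed simp

lemma tendsto_alt:
  assumes "\<And>F. finite F \<Longrightarrow> (\<lambda>k. \<phi> k F) \<longlonglongrightarrow> \<psi> F" "finite F"
  shows "(\<lambda>k. alt (\<phi> k) F gs) \<longlonglongrightarrow> alt \<psi> F gs"
  using assms(2) by (induction gs arbitrary: F) (auto intro!: tendsto_diff assms(1))

section \<open>Void probabilities as finite products\<close>

lemma mem_sumset_iff: "t \<in> sumset k F \<longleftrightarrow> (\<exists>x\<in>F. t - x \<in> digit_set k)"
  by (force simp: sumset_def image_iff)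

lemma completely_monotone_exp_capacity: "completely_monotone (\<lambda>F. exp (- capacity k F))"
  unfolding completely_monotone_def
proof (intro allI impI)
  fix F :: "int set" and gs assume F: "finite F"
  \<comment> \<open>In a Poisson scattering of intensity \<open>1 / nwords k\<close> a given integer
    carries no point with probability \<open>q\<close>. A point at \<open>t\<close> erases
    \<open>B t\<close>, which meets \<open>H\<close> exactly if \<open>t\<close> lies in
    \<open>sumset k H\<close>, so survival of \<open>H\<close> costs one factor \<open>q\<close> for
    each element of that sumset.\<close>
  define q where "q = exp (- 1 / real (nwords k))"
  define B where "B t = {x. t - x \<in> digit_set k}" for t
  define T where "T = sumset k (F \<union> set gs)"
  have T: "finite T" using F by (simp add: T_def)
  have "alt (\<lambda>F. exp (- capacity k F)) F gs = alt (\<lambda>H. \<Prod>t\<in>T. if H \<inter> B t = {} then 1 else q) F gs"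
  proof (rule alt_cong)
    fix H assume H: "F \<subseteq> H" "H \<subseteq> F \<union> set gs"
    have "T \<inter> {t. H \<inter> B t \<noteq> {}} = sumset k H"
    proof -
      have "sumset k H \<subseteq> T" unfolding T_def sumset_def using H(2) by (rule UN_mono) simp
      moreover have "H \<inter> B t \<noteq> {} \<longleftrightarrow> t \<in> sumset k H" for t
        unfolding B_def mem_sumset_iff by auto
      ultimately show ?thesis by auto
    qed
    moreover have "(\<Prod>t\<in>T. if H \<inter> B t = {} then 1 else q) = (\<Prod>t\<in>T. if H \<inter> B t \<noteq> {} then q else 1)"
      by (intro prod.cong) auto
    ultimately have "(\<Prod>t\<in>T. if H \<inter> B t = {} then 1 else q) = q ^ card (sumset k H)"
      using T by (simp add: prod.If_cases)
    also have "\<dots> = exp (- capacity k H)"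
      by (simp add: q_def capacity_def exp_of_nat_mult[symmetric])
    finally show "exp (- capacity k H) = (\<Prod>t\<in>T. if H \<inter> B t = {} then 1 else q)" ..
  qed
  moreover have "completely_monotone (\<lambda>H. \<Prod>t\<in>T. if H \<inter> B t = {} then 1 else q)"
    by (intro completely_monotone_prod T completely_monotone_hit) (auto simp: q_def)
  ultimately show "0 \<le> alt (\<lambda>F. exp (- capacity k F)) F gs"
    using F by (simp add: completely_monotoneD)
qed

lemma completely_monotone_exp_lim_capacity: "completely_monotone (\<lambda>F. exp (- lim_capacity F))"
  unfolding completely_monotone_def
proof (intro allI impI)
  fix F :: "int set" and gs assume F: "finite F"
  have "(\<lambda>k. alt (\<lambda>F. exp (- capacity k F)) F gs) \<longlonglongrightarrow> alt (\<lambda>F. exp (- lim_capacity F)) F gs"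
    by (rule tendsto_alt) (auto intro!: tendsto_intros capacity_tendsto F)
  then show "0 \<le> alt (\<lambda>F. exp (- lim_capacity F)) F gs"
    by (rule LIMSEQ_le_const)
       (use completely_monotoneD[OF completely_monotone_exp_capacity F] in auto)
qed

section \<open>Realisation on the unit interval\<close>

text \<open>The head of a word is its newest symbol: in \<open>b # w\<close> the symbol
  \<open>b\<close> belongs to the coordinate \<open>int_decode (length w)\<close>, so words of
  length \<open>k\<close> describe the first \<open>k\<close> integers in the enumeration
  \<open>int_decode\<close>.\<close>

primrec ones :: "bool list \<Rightarrow> int set" where
  "ones [] = {}"
| "ones (b # w) = (if b then insert (int_decode (length w)) (ones w) else ones w)"

primrec zeros :: "bool list \<Rightarrow> int list" where
  "zeros [] = []"
| "zeros (b # w) = (if b then zeros w else int_decode (length w) # zeros w)"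

lemma finite_ones [simp]: "finite (ones w)"
  by (induction w) auto

abbreviation spins :: "(int \<Rightarrow> bool) measure" where
  "spins \<equiv> PiM UNIV (\<lambda>_. count_space UNIV)"

lemma space_spins [simp]: "space spins = UNIV"
  by (simp add: space_PiM)

lemma UNIV_sets_spins: "UNIV \<in> sets spins"
  using sets.top[of spins] unfolding space_spins .

definition all_ones :: "int set \<Rightarrow> (int \<Rightarrow> bool) set" where
  "all_ones F = {\<omega>. \<forall>n\<in>F. \<omega> n}"

lemma sets_coordinate: "{\<omega>. \<omega> i \<in> A} \<in> sets spins"
proof -
  have "(\<lambda>\<omega>. \<omega> i) -` A \<inter> space spins \<in> sets spins"
    by (rule measurable_sets[OF measurable_component_singleton]) auto
  then show ?thesis by (simp add: vimage_def)
qed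

lemma sets_all_ones [measurable]: "all_ones F \<in> sets spins"
proof -
  have "all_ones F = (\<Inter>n\<in>F. {\<omega>. \<omega> n \<in> {True}})"
    by (auto simp: all_ones_def)
  also have "\<dots> \<in> sets spins"
    by (intro sets.countable_INT'' UNIV_sets_spins sets_coordinate countableI_type)
  finally show ?thesis .
qed

abbreviation unit_interval :: "real measure" where
  "unit_interval \<equiv> restrict_space lborel {0..<1}"

lemma prob_space_unit_interval: "prob_space unit_interval"
  by (rule prob_spaceI) (simp add: emeasure_restrict_space space_restrict_space)

section \<open>Subdivision of the unit interval by cylinder masses\<close>

locale void_functional =
  fixes \<phi> :: "int set \<Rightarrow> real"
  assumes cm: "completely_monotone \<phi>" and empty [simp]: "\<phi> {} = 1"
begin

definition mass :: "bool list \<Rightarrow> real" where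
  "mass w = alt \<phi> (ones w) (zeros w)"

text \<open>Each interval is cut into a left piece for \<open>False\<close> and a right piece for
  \<open>True\<close> whose lengths are the cylinder masses; pieces of mass zero are empty. Reading
  off the pieces that contain \<open>x\<close> then carries Lebesgue measure to the law of the
  process.\<close>

primrec left_end :: "bool list \<Rightarrow> real" where
  "left_end [] = 0"
| "left_end (b # w) = left_end w + (if b then mass (False # w) else 0)"

definition cell :: "bool list \<Rightarrow> real set" where
  "cell w = {left_end w..<left_end w + mass w}"

primrec word :: "nat \<Rightarrow> real \<Rightarrow> bool list" where
  "word 0 x = []"
| "word (Suc k) x = (left_end (word k x) + mass (False # word k x) \<le> x) # word k x"

definition code :: "real \<Rightarrow> int \<Rightarrow> bool" where
  "code x n = hd (word (Suc (int_encode n)) x)"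

lemma mass_nonneg: "0 \<le> mass w"
  unfolding mass_def by (rule completely_monotoneD[OF cm]) simp

lemma mass_split: "mass (False # w) + mass (True # w) = mass w"
  by (simp add: mass_def)

lemma cell_Nil: "cell [] = {0..<1}"
  by (simp add: cell_def mass_def)

lemma cell_Cons: "cell (b # w) = {x \<in> cell w. b \<longleftrightarrow> left_end w + mass (False # w) \<le> x}"
  using mass_split[of w] mass_nonneg[of "True # w"] mass_nonneg[of "False # w"]
  by (cases b) (auto simp: cell_def)

lemma cell_subset: "cell w \<subseteq> {0..<1}"
  by (induction w) (auto simp: cell_Nil cell_Cons)

lemma length_word [simp]: "length (word k x) = k"
  by (induction k) auto

lemma mem_cell_iff: "x \<in> {0..<1} \<Longrightarrow> x \<in> cell w \<longleftrightarrow> word (length w) x = w"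
  by (induction w) (auto simp: cell_Nil cell_Cons)

lemma mem_cell_word: "x \<in> {0..<1} \<Longrightarrow> x \<in> cell (word k x)"
  by (subst mem_cell_iff) auto

lemma measurable_word [measurable]: "word k \<in> borel \<rightarrow>\<^sub>M count_space UNIV"
proof (induction k)
  case (Suc k)
  note [measurable] = Suc
  have *: "(\<lambda>x. (left_end w + mass (False # w) \<le> x) # w) \<in> borel \<rightarrow>\<^sub>M count_space UNIV" for w
    by (rule measurable_compose[of "\<lambda>x. left_end w + mass (False # w) \<le> x" _ "count_space UNIV"]) auto
  show ?case unfolding word.simps
    by (rule measurable_compose_countable[OF * Suc])
qed simp

lemma measurable_code [measurable]: "code \<in> borel \<rightarrow>\<^sub>M spins"
proof (rule measurable_PiM_single')
  fix n
  show "(\<lambda>x. code x n) \<in> borel \<rightarrow>\<^sub>M count_space UNIV"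
    unfolding code_def by (rule measurable_compose[OF measurable_word]) simp
qed auto

lemma measurable_code_unit [measurable]: "code \<in> unit_interval \<rightarrow>\<^sub>M spins"
  by (rule measurable_restrict_space1) simp

lemma sets_cell [measurable]: "cell w \<in> sets unit_interval"
  using cell_subset[of w] by (auto simp: sets_restrict_space cell_def)

lemma sets_cell_code: "{x \<in> cell w. \<forall>n\<in>H. code x n} \<in> sets unit_interval"
proof -
  have "{x \<in> cell w. \<forall>n\<in>H. code x n} = cell w \<inter> (code -` all_ones H \<inter> space unit_interval)"
    using cell_subset[of w] by (auto simp: space_restrict_space all_ones_def)
  also have "\<dots> \<in> sets unit_interval"
    by (intro sets.Int sets_cell measurable_sets[OF measurable_code_unit sets_all_ones])
  finally show ?thesis .
qed

lemma code_cell_Cons: "x \<in> cell (b # w) \<Longrightarrow> code x (int_decode (length w)) = b"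
  using mem_cell_iff[of x "b # w"] cell_subset[of "b # w"] by (auto simp: code_def simp del: word.simps)

lemma measure_cell: "measure unit_interval (cell w) = mass w"
  using cell_subset[of w] mass_nonneg[of w]
  by (simp add: measure_restrict_space) (simp add: cell_def)

text \<open>Induction on the number \<open>d\<close> of coordinates that \<open>H\<close> may still
  involve. If the next coordinate \<open>n\<close> lies in \<open>H\<close>, only the
  \<open>True\<close> part of the cell contributes; otherwise both parts do, and the recursion of
  \<open>alt\<close> adds their measures.\<close>

lemma measure_cell_code:
  "H \<subseteq> int_decode ` {length w..<length w + d} \<Longrightarrow>
    measure unit_interval {x \<in> cell w. \<forall>n\<in>H. code x n} = alt \<phi> (ones w \<union> H) (zeros w)"
proof (induction d arbitrary: w H)
  case 0
  then show ?case by (simp add: measure_cell mass_def)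
next
  case (Suc d)
  interpret U: prob_space unit_interval by (rule prob_space_unit_interval)
  define n where "n = int_decode (length w)"
  have IH: "measure unit_interval {x \<in> cell (b # w). \<forall>m\<in>H - {n}. code x m} =
      alt \<phi> (ones (b # w) \<union> (H - {n})) (zeros (b # w))" for b
  proof (rule Suc.IH)
    have "{length w..<length w + Suc d} = insert (length w) {length (b # w)..<length (b # w) + d}"
      by auto
    then show "H - {n} \<subseteq> int_decode ` {length (b # w)..<length (b # w) + d}"
      using Suc.prems by (auto simp: n_def)
  qed
  have code_n: "code x n = b" if "x \<in> cell (b # w)" for x b
    using code_cell_Cons[OF that] by (simp add: n_def)
  have split: "x \<in> cell w \<longleftrightarrow> x \<in> cell (True # w) \<or> x \<in> cell (False # w)" for x
    by (auto simp: cell_Cons)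
  have disj: "cell (True # w) \<inter> cell (False # w) = {}" by (auto simp: cell_Cons)
  show ?case
  proof (cases "n \<in> H")
    case True
    then have "{x \<in> cell w. \<forall>n\<in>H. code x n} = {x \<in> cell (True # w). \<forall>m\<in>H - {n}. code x m}"
      using code_n by (auto simp: split)
    moreover have "ones (True # w) \<union> (H - {n}) = ones w \<union> H"
      using True by (auto simp: n_def)
    ultimately show ?thesis using IH[of True] by simp
  next
    case False
    then have "{x \<in> cell w. \<forall>n\<in>H. code x n} =
        {x \<in> cell (True # w). \<forall>m\<in>H - {n}. code x m} \<union> {x \<in> cell (False # w). \<forall>m\<in>H - {n}. code x m}"
      by (auto simp: split)
    then have "measure unit_interval {x \<in> cell w. \<forall>n\<in>H. code x n} =
       measure unit_interval {x \<in> cell (True # w). \<forall>m\<in>H - {n}. code x m} +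
       measure unit_interval {x \<in> cell (False # w). \<forall>m\<in>H - {n}. code x m}"
      using disj by (simp only:) (rule U.finite_measure_Union; (rule sets_cell_code)?; blast)
    also have "\<dots> = alt \<phi> (insert n (ones w) \<union> H) (zeros w) + alt \<phi> (ones w \<union> H) (n # zeros w)"
      using IH[of True] IH[of False] False by (simp add: n_def)
    finally show ?thesis by simp
  qed
qed

end

section \<open>Rigidity and weak mixing of the shift\<close>

text \<open>Dynkin's argument for set functions that are merely subadditive. Comparison with
  \<open>prob\<close> makes the tail of a disjoint union small uniformly in \<open>k\<close>, which
  leaves finitely many pieces for the limit. It is applied to symmetric differences and to averaged
  correlations.\<close>

lemma (in prob_space) tendsto_0_sigma_sets:
  fixes s :: "nat \<Rightarrow> 'a set \<Rightarrow> real"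
  assumes gen: "Int_stable V" "V \<subseteq> Pow (space M)" "sets M = sigma_sets (space M) V"
    and compl: "\<And>k A. A \<in> sets M \<Longrightarrow> s k (space M - A) = s k A"
    and subadd: "\<And>k A B. A \<in> sets M \<Longrightarrow> B \<in> sets M \<Longrightarrow> A \<inter> B = {} \<Longrightarrow> s k (A \<union> B) \<le> s k A + s k B"
    and nonneg: "\<And>k A. 0 \<le> s k A"
    and bound: "\<And>k A. A \<in> sets M \<Longrightarrow> s k A \<le> 2 * prob A"
    and base: "\<And>A. A \<in> V \<Longrightarrow> (\<lambda>k. s k A) \<longlonglongrightarrow> 0"
    and A: "A \<in> sets M"
  shows "(\<lambda>k. s k A) \<longlonglongrightarrow> 0"
proof -
  have "A \<in> sigma_sets (space M) V" using A gen by simp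
  then show ?thesis
  proof (induction rule: sigma_sets_induct_disjoint[OF gen(1,2), consumes 1,
        case_names basic empty compl union])
    case (basic A)
    then show ?case by (rule base)
  next
    case empty
    have "s k {} = 0" for k using bound[of "{}" k] nonneg[of k "{}"] by simp
    then show ?case by simp
  next
    case (compl A)
    then show ?case using assms(4) gen by simp
  next
    case (union A)
    have A: "A i \<in> sets M" for i using union(2) gen by auto
    define B where "B n = (\<Union>i<n. A i)" for n
    have B: "B n \<in> sets M" for n using A by (auto simp: B_def intro: less_SucI)
    have fin: "(\<lambda>k. s k (B n)) \<longlonglongrightarrow> 0" for n
    proof (induction n)
      case 0
      have "s k {} = 0" for k using bound[of "{}" k] nonneg[of k "{}"] by simp
      then show ?case by (simp add: B_def)
    next
      case (Suc n)
      have "A i \<inter> A n = {}" if "i < n" for i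
        using union(1) that by (auto simp: disjoint_family_on_def)
      then have "B n \<inter> A n = {}" unfolding B_def by blast
      moreover have "B (Suc n) = B n \<union> A n" by (auto simp: B_def less_Suc_eq)
      ultimately have "s k (B (Suc n)) \<le> s k (B n) + s k (A n)" for k
        using subadd[OF B A, of n n k] by simp
      moreover have "(\<lambda>k. s k (B n) + s k (A n)) \<longlonglongrightarrow> 0"
        using tendsto_add[OF Suc union(3)[of n]] by simp
      ultimately show ?case
        by (intro tendsto_sandwich[of "\<lambda>_. 0" "\<lambda>k. s k (B (Suc n))" sequentially
              "\<lambda>k. s k (B n) + s k (A n)" 0]) (auto simp: nonneg)
    qed
    let ?U = "\<Union>i. A i"
    have U: "?U \<in> sets M" using A by auto
    have "?U = (\<Union>n. B n)" by (auto simp: B_def intro: less_SucI)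
    moreover have "incseq B" by (intro incseq_SucI) (auto simp: B_def intro: less_SucI)
    ultimately have lim: "(\<lambda>n. prob (B n)) \<longlonglongrightarrow> prob ?U"
      using finite_Lim_measure_incseq[of B] B by auto
    show ?case
    proof (rule LIMSEQ_I)
      fix e :: real assume e: "e > 0"
      have "\<forall>\<^sub>F n in sequentially. prob ?U - e / 4 < prob (B n)"
        by (rule order_tendstoD[OF lim]) (use e in auto)
      then obtain n where n: "prob ?U - e / 4 < prob (B n)" by (auto simp: eventually_sequentially)
      have "B n \<subseteq> ?U" by (auto simp: B_def intro: less_SucI)
      then have tail: "2 * prob (?U - B n) < e / 2"
        using n finite_measure_Diff[OF U B] by simp
      have "\<forall>\<^sub>F k in sequentially. s k (B n) < e / 2"
        by (rule order_tendstoD[OF fin]) (use e in auto)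
      then obtain K where K: "\<And>k. k \<ge> K \<Longrightarrow> s k (B n) < e / 2" by (auto simp: eventually_sequentially)
      have "norm (s k ?U - 0) < e" if "k \<ge> K" for k
      proof -
        have "s k (B n \<union> (?U - B n)) \<le> s k (B n) + s k (?U - B n)"
          by (rule subadd) (use B U in auto)
        also have "B n \<union> (?U - B n) = ?U" using \<open>B n \<subseteq> ?U\<close> by auto
        finally have "s k ?U < e"
          using bound[of "?U - B n" k] tail K[OF that] U B by auto
        then show ?thesis using nonneg[of k ?U] by simp
      qed
      then show "\<exists>K. \<forall>k\<ge>K. norm (s k ?U - 0) < e" by blast
    qed
  qed
qed

section \<open>The shift on two-sided binary sequences\<close>

definition shift_by :: "int \<Rightarrow> (int \<Rightarrow> bool) \<Rightarrow> int \<Rightarrow> bool" where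
  "shift_by n \<omega> = (\<lambda>j. \<omega> (j - n))"

lemma all_ones_Un: "all_ones (F \<union> G) = all_ones F \<inter> all_ones G"
  by (auto simp: all_ones_def)

lemma Int_stable_all_ones: "Int_stable (all_ones ` Collect finite)"
  by (auto simp: Int_stable_def all_ones_Un[symmetric])

text \<open>The events \<open>all_ones F\<close> involve only the symbol \<open>True\<close>; those
  for \<open>False\<close> come by complementation. Hence a probability law on sequences is
  determined by its values on this intersection-stable family.\<close>

lemma sets_spins: "sets spins = sigma_sets UNIV (all_ones ` Collect finite)"
proof
  have "all_ones ` Collect finite \<subseteq> sets spins" by auto
  from sets.sigma_sets_subset[OF this]
  show "sigma_sets UNIV (all_ones ` Collect finite) \<subseteq> sets spins" by simp
  have *: "{\<omega>. \<omega> i \<in> A} \<in> sigma_sets UNIV (all_ones ` Collect finite)" for i and A :: "bool set"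
  proof -
    have 1: "{\<omega>. \<omega> i} \<in> sigma_sets UNIV (all_ones ` Collect finite)"
      by (rule sigma_sets.Basic) (auto simp: all_ones_def intro!: image_eqI[of _ _ "{i}"])
    then have "UNIV - {\<omega>. \<omega> i} \<in> sigma_sets UNIV (all_ones ` Collect finite)"
      by (rule sigma_sets.Compl)
    then have 2: "{\<omega>. \<not> \<omega> i} \<in> sigma_sets UNIV (all_ones ` Collect finite)"
      by (simp add: Compl_eq_Diff_UNIV[symmetric] Collect_neg_eq)
    have eq: "{\<omega>. \<omega> i \<in> A} = {\<omega>. \<omega> i \<and> True \<in> A} \<union> {\<omega>. \<not> \<omega> i \<and> False \<in> A}"
    proof (rule set_eqI)
      fix \<omega> :: "int \<Rightarrow> bool"
      show "\<omega> \<in> {\<omega>. \<omega> i \<in> A} \<longleftrightarrow> \<omega> \<in> {\<omega>. \<omega> i \<and> True \<in> A} \<union> {\<omega>. \<not> \<omega> i \<and> False \<in> A}"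
        by (cases "\<omega> i") auto
    qed
    show ?thesis unfolding eq using 1 2
      by (intro sigma_sets_Un) (cases "True \<in> A"; cases "False \<in> A"; simp add: sigma_sets.Empty)+
  qed
  show "sets spins \<subseteq> sigma_sets UNIV (all_ones ` Collect finite)"
  proof
    fix A assume A: "A \<in> sets spins"
    let ?S = "sigma UNIV (all_ones ` Collect finite)"
    have "(\<lambda>\<omega>. \<omega>) \<in> ?S \<rightarrow>\<^sub>M spins"
    proof (rule measurable_PiM_single')
      show "(\<lambda>\<omega>. \<omega> i) \<in> ?S \<rightarrow>\<^sub>M count_space UNIV" for i
        by (rule measurableI) (use * in \<open>auto simp: vimage_def\<close>)
    qed auto
    from measurable_sets[OF this A] show "A \<in> sigma_sets UNIV (all_ones ` Collect finite)" by simp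
  qed
qed

lemma shift_0 [simp]: "shift_by 0 \<omega> = \<omega>"
  by (simp add: shift_by_def)

lemma shift_shift [simp]: "shift_by m (shift_by n \<omega>) = shift_by (m + n) \<omega>"
  by (simp add: shift_by_def algebra_simps)

lemma shift_image: "shift_by n ` A = {\<omega>. shift_by (- n) \<omega> \<in> A}"
proof (intro set_eqI iffI)
  fix \<omega> assume "\<omega> \<in> {\<omega>. shift_by (- n) \<omega> \<in> A}"
  then show "\<omega> \<in> shift_by n ` A"
    by (intro image_eqI[of _ _ "shift_by (- n) \<omega>"]) auto
qed auto

lemma shift_all_ones: "shift_by n ` all_ones F = all_ones ((+) n ` F)"
  unfolding shift_image by (auto simp: all_ones_def shift_by_def add.commute)

lemma measurable_shift [measurable]: "shift_by n \<in> spins \<rightarrow>\<^sub>M spins"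
  unfolding shift_by_def by (rule measurable_PiM_single') auto

lemma sets_shift_image [measurable]: "A \<in> sets spins \<Longrightarrow> shift_by n ` A \<in> sets spins"
  using measurable_sets[OF measurable_shift, of A "- n"] by (simp add: shift_image vimage_def)

lemma sets_singleton_spins [measurable]: "{\<omega>} \<in> sets spins"
proof -
  have "{\<omega>} = (\<Inter>n. {\<omega>'. \<omega>' n \<in> {\<omega> n}})" by auto
  also have "\<dots> \<in> sets spins"
    by (intro sets.countable_INT'' UNIV_sets_spins sets_coordinate countableI_type)
  finally show ?thesis .
qed

context void_functional
begin

definition law :: "(int \<Rightarrow> bool) measure" where
  "law = distr unit_interval spins code"

lemma sets_law [simp, measurable_cong]: "sets law = sets spins"
  by (simp add: law_def)

lemma space_law [simp]: "space law = UNIV"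
  by (simp add: law_def)

lemma prob_space_law: "prob_space law"
  unfolding law_def by (intro prob_space.prob_space_distr prob_space_unit_interval measurable_code_unit)

lemma measure_law: "A \<in> sets spins \<Longrightarrow> measure law A = measure unit_interval {x \<in> {0..<1}. code x \<in> A}"
  unfolding law_def
  by (subst measure_distr) (auto simp: space_restrict_space intro!: arg_cong[of _ _ "measure unit_interval"])

lemma measure_all_ones: "finite F \<Longrightarrow> measure law (all_ones F) = \<phi> F"
proof -
  assume "finite F"
  then obtain d where d: "int_encode ` F \<subseteq> {..<d}"
    using finite_nat_iff_bounded[of "int_encode ` F"] by auto
  have "F = int_decode ` int_encode ` F" by (simp add: image_image)
  also have "\<dots> \<subseteq> int_decode ` {length ([] :: bool list)..<length ([] :: bool list) + d}"
    using d by (intro image_mono) auto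
  finally show ?thesis
    using measure_cell_code[of F "[]" d] measure_law[OF sets_all_ones, of F]
    by (simp add: cell_Nil all_ones_def)
qed

end

section \<open>Cesaro means and the dynamics of the law\<close>

definition mean_abs :: "(nat \<Rightarrow> real) \<Rightarrow> nat \<Rightarrow> real" where
  "mean_abs c N = 1 / real N * (\<Sum>n<N. \<bar>c n\<bar>)"

lemma mean_abs_nonneg: "0 \<le> mean_abs c N"
  unfolding mean_abs_def by (intro mult_nonneg_nonneg sum_nonneg) auto

lemma mean_abs_le:
  assumes "\<And>n. \<bar>c n\<bar> \<le> C"
  shows "mean_abs c N \<le> C"
proof -
  have "0 \<le> C" using assms[of 0] by linarith
  moreover have "(\<Sum>n<N. \<bar>c n\<bar>) \<le> (\<Sum>n<N. C)" by (intro sum_mono assms)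
  ultimately show ?thesis by (cases "N = 0") (auto simp: mean_abs_def field_simps)
qed

lemma mean_abs_add:
  assumes "\<And>n. c n = d n + e n"
  shows "mean_abs c N \<le> mean_abs d N + mean_abs e N"
proof -
  have "(\<Sum>n<N. \<bar>c n\<bar>) \<le> (\<Sum>n<N. \<bar>d n\<bar> + \<bar>e n\<bar>)" by (intro sum_mono) (simp add: assms abs_triangle_ineq)
  then have "1 / real N * (\<Sum>n<N. \<bar>c n\<bar>) \<le> 1 / real N * (\<Sum>n<N. \<bar>d n\<bar> + \<bar>e n\<bar>)"
    by (intro mult_left_mono) auto
  then show ?thesis by (simp add: mean_abs_def sum.distrib distrib_left)
qed

lemma mean_abs_minus: "(\<And>n. c n = - d n) \<Longrightarrow> mean_abs c N = mean_abs d N"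
  by (simp add: mean_abs_def)

text \<open>\<open>cesaro\<close> and \<open>rigid_times\<close> express weak mixing and rigidity on
  the generating events \<open>all_ones F\<close> alone; \<open>nontrivial\<close> excludes a law
  concentrated on one sequence.\<close>

locale mixing_void_functional = void_functional +
  fixes h :: "nat \<Rightarrow> nat"
  assumes stationary: "\<phi> ((+) n ` F) = \<phi> F"
    and cesaro: "finite F \<Longrightarrow> finite G \<Longrightarrow>
      mean_abs (\<lambda>n. \<phi> ((+) (int n) ` F \<union> G) - \<phi> F * \<phi> G) \<longlonglongrightarrow> 0"
    and rigid_times: "finite F \<Longrightarrow> (\<lambda>k. \<phi> ((+) (int (h k)) ` F \<union> F)) \<longlonglongrightarrow> \<phi> F"
    and nontrivial: "0 < \<phi> {0}" "\<phi> {0} < 1"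
begin

sublocale law: prob_space law by (rule prob_space_law)

lemma distr_shift: "distr law law (shift_by n) = law"
proof (rule measure_eqI_generator_eq[OF Int_stable_all_ones, of UNIV _ _ "\<lambda>_. UNIV"])
  fix X assume "X \<in> all_ones ` Collect finite"
  then obtain F where F: "finite F" "X = all_ones F" by auto
  have "shift_by n -` all_ones F = all_ones ((+) (- n) ` F)"
    using shift_image[of "- n" "all_ones F"] shift_all_ones[of "- n" F] by (simp add: vimage_def)
  then show "emeasure (distr law law (shift_by n)) X = emeasure law X"
    using F by (simp add: emeasure_distr law.emeasure_eq_measure measure_all_ones stationary[of "- n" F, simplified])
next
  show "range (\<lambda>_. UNIV) \<subseteq> all_ones ` Collect finite"
    by (auto simp: all_ones_def intro!: image_eqI[of _ _ "{}"])
next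
  have "prob_space (distr law law (shift_by n))" by (intro law.prob_space_distr) simp
  then show "emeasure (distr law law (shift_by n)) UNIV \<noteq> \<infinity>"
    by (simp add: prob_space_def finite_measure.emeasure_finite)
qed (auto simp: sets_spins[symmetric])

lemma measure_shift: "A \<in> sets spins \<Longrightarrow> measure law (shift_by n ` A) = measure law A"
proof -
  assume A: "A \<in> sets spins"
  have "measure law A = measure (distr law law (shift_by (- n))) A" by (simp add: distr_shift)
  also have "\<dots> = measure law (shift_by n ` A)"
    using A by (subst measure_distr) (auto simp: shift_image vimage_def)
  finally show ?thesis ..
qed

lemma shift_image_Un: "shift_by n ` (A \<union> B) = shift_by n ` A \<union> shift_by n ` B" by auto

text \<open>On a generator \<open>all_ones F\<close> the symmetric difference has measure
  \<open>2 * \<phi> F\<close> minus twice the value of \<open>\<phi>\<close> at the union of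
  \<open>F\<close> with its translate, which tends to 0 by \<open>rigid_times\<close>.
  \<open>tendsto_0_sigma_sets\<close> extends this to all events.\<close>

lemma rigid_law:
  assumes "A \<in> sets spins"
  shows "(\<lambda>k. measure law (sym_diff (shift_by (int (h k)) ` A) A)) \<longlonglongrightarrow> 0"
proof (rule law.tendsto_0_sigma_sets[OF Int_stable_all_ones])
  let ?s = "\<lambda>k A. measure law (sym_diff (shift_by (int (h k)) ` A) A)"
  show "?s k (space law - A) = ?s k A" for k A
    by (rule arg_cong[of _ _ "measure law"]) (auto simp: shift_image)
  show "?s k (A \<union> B) \<le> ?s k A + ?s k B" if "A \<in> sets law" "B \<in> sets law" for k A B
  proof -
    have "?s k (A \<union> B) \<le> measure law (sym_diff (shift_by (int (h k)) ` A) A \<union> sym_diff (shift_by (int (h k)) ` B) B)"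
      using that by (intro law.finite_measure_mono) auto
    also have "\<dots> \<le> ?s k A + ?s k B" using that by (intro measure_Un_le) auto
    finally show ?thesis .
  qed
  show "?s k A \<le> 2 * measure law A" if "A \<in> sets law" for k A
  proof -
    have "?s k A \<le> measure law (shift_by (int (h k)) ` A \<union> A)"
      using that by (intro law.finite_measure_mono) auto
    also have "\<dots> \<le> measure law (shift_by (int (h k)) ` A) + measure law A"
      using that by (intro measure_Un_le) auto
    finally show ?thesis using that measure_shift[of A] by simp
  qed
  show "(\<lambda>k. ?s k A) \<longlonglongrightarrow> 0" if V: "A \<in> all_ones ` Collect finite" for A
  proof -
    obtain F where F: "finite F" "A = all_ones F" using V by auto
    have A: "A \<in> sets spins" using F by simp
    have "?s k A = 2 * \<phi> F - 2 * \<phi> ((+) (int (h k)) ` F \<union> F)" for k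
    proof -
      let ?B = "shift_by (int (h k)) ` A"
      have "?s k A = measure law (?B - A) + measure law (A - ?B)"
        using A by (intro law.finite_measure_Union) auto
      also have "\<dots> = (measure law ?B - measure law (?B \<inter> A)) + (measure law A - measure law (?B \<inter> A))"
        using A by (simp add: law.finite_measure_Diff' Int_commute)
      also have "?B \<inter> A = all_ones ((+) (int (h k)) ` F \<union> F)"
        by (simp add: F shift_all_ones all_ones_Un)
      finally show ?thesis using F A by (simp add: measure_shift measure_all_ones)
    qed
    moreover have "(\<lambda>k. 2 * \<phi> F - 2 * \<phi> ((+) (int (h k)) ` F \<union> F)) \<longlonglongrightarrow> 2 * \<phi> F - 2 * \<phi> F"
      by (intro tendsto_intros rigid_times F)
    ultimately show ?thesis by simp
  qed
qed (use assms in \<open>auto simp: sets_spins\<close>)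

definition correlation :: "(int \<Rightarrow> bool) set \<Rightarrow> (int \<Rightarrow> bool) set \<Rightarrow> nat \<Rightarrow> real" where
  "correlation B C n = measure law (shift_by (int n) ` B \<inter> C) - measure law B * measure law C"

text \<open>The second estimate controls tails when \<open>C\<close> varies, the first when
  \<open>B\<close> varies.\<close>

lemma correlation_bounds:
  assumes B: "B \<in> sets spins" and C: "C \<in> sets spins"
  shows "\<bar>correlation B C n\<bar> \<le> 2 * measure law B" "\<bar>correlation B C n\<bar> \<le> 2 * measure law C"
proof -
  have "measure law (shift_by (int n) ` B \<inter> C) \<le> measure law (shift_by (int n) ` B)"
    "measure law (shift_by (int n) ` B \<inter> C) \<le> measure law C"
    using B C by (auto intro!: law.finite_measure_mono)
  moreover have "measure law B * measure law C \<le> measure law B" "measure law B * measure law C \<le> measure law C"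
    by (auto intro: mult_left_le mult_left_le_one_le)
  moreover have "0 \<le> measure law B * measure law C" by simp
  ultimately show "\<bar>correlation B C n\<bar> \<le> 2 * measure law B" "\<bar>correlation B C n\<bar> \<le> 2 * measure law C"
    using measure_shift[OF B, of "int n"] measure_nonneg[of law "shift_by (int n) ` B \<inter> C"]
      measure_nonneg[of law B] measure_nonneg[of law C] unfolding correlation_def by linarith+
qed

lemma correlation_Compl:
  assumes B: "B \<in> sets spins" and C: "C \<in> sets spins"
  shows "correlation B (UNIV - C) n = - correlation B C n" "correlation (UNIV - B) C n = - correlation B C n"
proof -
  let ?S = "shift_by (int n) ` B"
  have "measure law (?S - C) = measure law ?S - measure law (?S \<inter> C)"
    "measure law (C - ?S) = measure law C - measure law (?S \<inter> C)"
    using B C by (auto simp: law.finite_measure_Diff' Int_commute)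
  moreover have "?S \<inter> (UNIV - C) = ?S - C" "shift_by (int n) ` (UNIV - B) \<inter> C = C - ?S"
    by (auto simp: shift_image)
  moreover have "measure law (UNIV - B) = 1 - measure law B" "measure law (UNIV - C) = 1 - measure law C"
    using law.prob_compl[of B] law.prob_compl[of C] B C by auto
  ultimately show "correlation B (UNIV - C) n = - correlation B C n" "correlation (UNIV - B) C n = - correlation B C n"
    using measure_shift[OF B, of "int n"] by (auto simp: correlation_def right_diff_distrib left_diff_distrib)
qed

lemma correlation_Un:
  assumes "A \<in> sets spins" "B \<in> sets spins" "C \<in> sets spins" "A \<inter> B = {}"
  shows "correlation C (A \<union> B) n = correlation C A n + correlation C B n"
    "correlation (A \<union> B) C n = correlation A C n + correlation B C n"
proof -
  have AB: "measure law (A \<union> B) = measure law A + measure law B"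
    using assms by (intro law.finite_measure_Union) auto
  have "measure law (shift_by (int n) ` C \<inter> (A \<union> B)) =
      measure law (shift_by (int n) ` C \<inter> A) + measure law (shift_by (int n) ` C \<inter> B)"
    unfolding Int_Un_distrib using assms by (intro law.finite_measure_Union) auto
  then show "correlation C (A \<union> B) n = correlation C A n + correlation C B n"
    by (simp add: correlation_def AB algebra_simps)
  have "measure law (shift_by (int n) ` (A \<union> B) \<inter> C) =
      measure law (shift_by (int n) ` A \<inter> C) + measure law (shift_by (int n) ` B \<inter> C)"
    unfolding shift_image_Un Int_Un_distrib2 using assms
    by (intro law.finite_measure_Union) (auto simp: shift_image)
  then show "correlation (A \<union> B) C n = correlation A C n + correlation B C n"
    by (simp add: correlation_def AB algebra_simps)
qed

text \<open>The extension from generators is done one variable at a time: first in \<open>C\<close>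
  with \<open>B = all_ones F\<close>, then in \<open>B\<close> with \<open>C\<close> arbitrary but
  fixed.\<close>

lemma weak_mixing_law:
  assumes B: "B \<in> sets spins" and C: "C \<in> sets spins"
  shows "mean_abs (correlation B C) \<longlonglongrightarrow> 0"
proof -
  have base: "mean_abs (correlation (all_ones F) (all_ones G)) \<longlonglongrightarrow> 0"
    if "finite F" "finite G" for F G
  proof -
    have "correlation (all_ones F) (all_ones G) = (\<lambda>n. \<phi> ((+) (int n) ` F \<union> G) - \<phi> F * \<phi> G)"
      using that by (auto simp: correlation_def shift_all_ones all_ones_Un[symmetric] measure_all_ones)
    then show ?thesis using cesaro[OF that] by simp
  qed
  have left: "mean_abs (correlation (all_ones F) C) \<longlonglongrightarrow> 0" if F: "finite F" for F
  proof (rule law.tendsto_0_sigma_sets[OF Int_stable_all_ones, of "\<lambda>N C. mean_abs (correlation (all_ones F) C) N"])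
    show "mean_abs (correlation (all_ones F) (space law - A)) N = mean_abs (correlation (all_ones F) A) N"
      if "A \<in> sets law" for N A
      using that by (intro mean_abs_minus) (simp add: correlation_Compl)
    show "mean_abs (correlation (all_ones F) A) \<longlonglongrightarrow> 0" if "A \<in> all_ones ` Collect finite" for A
      using that base F by auto
    show "mean_abs (correlation (all_ones F) (A \<union> B)) N \<le>
        mean_abs (correlation (all_ones F) A) N + mean_abs (correlation (all_ones F) B) N"
      if "A \<in> sets law" "B \<in> sets law" "A \<inter> B = {}" for N A B
      using that by (intro mean_abs_add correlation_Un) auto
    show "mean_abs (correlation (all_ones F) A) N \<le> 2 * measure law A" if "A \<in> sets law" for N A
      using that by (intro mean_abs_le correlation_bounds) auto
  qed (use C in \<open>simp_all add: mean_abs_nonneg sets_spins\<close>)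
  show ?thesis
  proof (rule law.tendsto_0_sigma_sets[OF Int_stable_all_ones, of "\<lambda>N B. mean_abs (correlation B C) N"])
    show "mean_abs (correlation (space law - A) C) N = mean_abs (correlation A C) N"
      if "A \<in> sets law" for N A
      using that C by (intro mean_abs_minus) (simp add: correlation_Compl)
    show "mean_abs (correlation A C) \<longlonglongrightarrow> 0" if "A \<in> all_ones ` Collect finite" for A
      using that left by auto
    show "mean_abs (correlation (A \<union> B) C) N \<le> mean_abs (correlation A C) N + mean_abs (correlation B C) N"
      if "A \<in> sets law" "B \<in> sets law" "A \<inter> B = {}" for N A B
      using that C by (intro mean_abs_add correlation_Un) auto
    show "mean_abs (correlation A C) N \<le> 2 * measure law A" if "A \<in> sets law" for N A
      using that C by (intro mean_abs_le correlation_bounds) auto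
  qed (use B in \<open>simp_all add: mean_abs_nonneg sets_spins\<close>)
qed

end

section \<open>Transfer to a Lebesgue space\<close>

context mixing_void_functional
begin

text \<open>An atom of mass \<open>q\<close> has all its self-correlations equal to \<open>q - q\<^sup>2\<close> or
  \<open>- q\<^sup>2\<close>, so weak mixing leaves only \<open>q = 0\<close> and \<open>q = 1\<close>.\<close>

lemma measure_singleton: "measure law {\<omega>} = 0"
proof -
  define q where "q = measure law {\<omega>}"
  define m where "m = min (q - q\<^sup>2) (q\<^sup>2)"
  have q: "0 \<le> q" "q \<le> 1" by (auto simp: q_def)
  have m: "m \<le> \<bar>correlation {\<omega>} {\<omega>} n\<bar>" for n
  proof (cases "shift_by (int n) \<omega> = \<omega>")
    case True
    then show ?thesis by (simp add: correlation_def m_def q_def power2_eq_square)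
  next
    case False
    then have "shift_by (int n) ` {\<omega>} \<inter> {\<omega>} = {}" by auto
    then show ?thesis by (simp add: correlation_def m_def q_def power2_eq_square)
  qed
  have "m \<le> mean_abs (correlation {\<omega>} {\<omega>}) N" if "N \<ge> 1" for N
  proof -
    have "(\<Sum>n<N. m) \<le> (\<Sum>n<N. \<bar>correlation {\<omega>} {\<omega>} n\<bar>)" by (intro sum_mono m)
    then show ?thesis using that by (simp add: mean_abs_def field_simps)
  qed
  then have "m \<le> 0"
    by (intro LIMSEQ_le_const[OF weak_mixing_law[of "{\<omega>}" "{\<omega>}"]] exI[of _ 1]) auto
  moreover have "q - q\<^sup>2 = q * (1 - q)" by (simp add: power2_eq_square algebra_simps)
  ultimately have "q * (1 - q) \<le> 0 \<or> q\<^sup>2 \<le> 0" by (simp add: m_def min_le_iff_disj)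
  then have "q = 0 \<or> q = 1"
    using q by (auto simp: mult_le_0_iff)
  moreover have "q \<noteq> 1"
  proof
    assume "q = 1"
    \<comment> \<open>A point of full mass would make coordinate 0 almost surely constant, against
      \<open>0 < \<phi> {0} < 1\<close>.\<close>
    show False
    proof (cases "\<omega> 0")
      case True
      then have "q \<le> measure law (all_ones {0})"
        unfolding q_def by (intro law.finite_measure_mono) (simp_all, simp add: all_ones_def)
      then show False using \<open>q = 1\<close> nontrivial measure_all_ones[of "{0}"] by simp
    next
      case False
      then have "measure law ({\<omega>} \<union> all_ones {0}) = q + measure law (all_ones {0})"
        unfolding q_def by (intro law.finite_measure_Union) (simp_all, simp add: all_ones_def)
      then show False
        using \<open>q = 1\<close> nontrivial measure_all_ones[of "{0}"] law.prob_le_1[of "{\<omega>} \<union> all_ones {0}"] by simp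
    qed
  qed
  ultimately show ?thesis by (simp add: q_def)
qed

section \<open>The inverse of the coding\<close>

primrec initial :: "nat \<Rightarrow> (int \<Rightarrow> bool) \<Rightarrow> bool list" where
  "initial 0 \<omega> = []"
| "initial (Suc k) \<omega> = \<omega> (int_decode k) # initial k \<omega>"

lemma length_initial [simp]: "length (initial k \<omega>) = k"
  by (induction k) auto

lemma word_eq_initial: "word k x = initial k (code x)"
  by (induction k) (auto simp: code_def)

lemma measurable_initial [measurable]: "initial k \<in> spins \<rightarrow>\<^sub>M count_space UNIV"
proof (induction k)
  case (Suc k)
  have *: "(\<lambda>\<omega>. \<omega> (int_decode k) # w) \<in> spins \<rightarrow>\<^sub>M count_space UNIV" for w
    by (rule measurable_compose[OF measurable_component_singleton]) auto
  show ?case unfolding initial.simps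
    by (rule measurable_compose_countable[OF * Suc])
qed simp

lemma mass_initial: "mass (initial k \<omega>) = measure law {\<omega>'. initial k \<omega>' = initial k \<omega>}"
proof -
  have "(initial k -` {initial k \<omega>}) \<inter> space spins \<in> sets spins"
    by (rule measurable_sets[OF measurable_initial]) auto
  then have "{\<omega>'. initial k \<omega>' = initial k \<omega>} \<in> sets spins" by (simp add: vimage_def)
  moreover have "{x \<in> {0..<1}. code x \<in> {\<omega>'. initial k \<omega>' = initial k \<omega>}} = cell (initial k \<omega>)"
    using cell_subset[of "initial k \<omega>"] by (auto simp: mem_cell_iff word_eq_initial)
  ultimately show ?thesis by (simp add: measure_law measure_cell)
qed

text \<open>The cylinders around \<open>\<omega>\<close> shrink to a single point, which is null by
  \<open>measure_singleton\<close>; so the cells shrink to length zero, and this is what makes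
  \<open>code\<close> injective on the unit interval.\<close>

lemma mass_initial_tendsto_0: "(\<lambda>k. mass (initial k \<omega>)) \<longlonglongrightarrow> 0"
proof -
  let ?A = "\<lambda>k. {\<omega>'. initial k \<omega>' = initial k \<omega>}"
  have "initial k -` {initial k \<omega>} \<inter> space spins \<in> sets spins" for k
    by (rule measurable_sets[OF measurable_initial]) auto
  then have A: "range ?A \<subseteq> sets law" by (auto simp: vimage_def)
  have "decseq ?A" by (intro decseq_SucI) auto
  from law.finite_Lim_measure_decseq[OF A this]
  have "(\<lambda>k. mass (initial k \<omega>)) \<longlonglongrightarrow> measure law (\<Inter>k. ?A k)" by (simp add: mass_initial)
  also have "(\<Inter>k. ?A k) = {\<omega>}"
  proof (intro equalityI subsetI)
    fix \<omega>' assume "\<omega>' \<in> (\<Inter>k. ?A k)"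
    then have "initial (Suc (int_encode n)) \<omega>' = initial (Suc (int_encode n)) \<omega>" for n by blast
    then show "\<omega>' \<in> {\<omega>}" by auto
  qed auto
  finally show ?thesis by (simp add: measure_singleton)
qed

definition decode :: "(int \<Rightarrow> bool) \<Rightarrow> real" where
  "decode \<omega> = lim (\<lambda>k. left_end (initial k \<omega>))"

lemma measurable_decode [measurable]: "decode \<in> spins \<rightarrow>\<^sub>M borel"
  unfolding decode_def
  by (intro borel_measurable_lim_metric measurable_compose[OF measurable_initial]) auto

lemma decode_code: "x \<in> {0..<1} \<Longrightarrow> decode (code x) = x"
proof -
  assume x: "x \<in> {0..<1}"
  have "\<bar>left_end (initial k (code x)) - x\<bar> \<le> mass (initial k (code x))" for k
    using mem_cell_word[OF x, of k] by (auto simp: word_eq_initial cell_def)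
  then have "(\<lambda>k. left_end (initial k (code x)) - x) \<longlonglongrightarrow> 0"
    by (intro Lim_null_comparison[OF _ mass_initial_tendsto_0[of "code x"]]) auto
  then show ?thesis unfolding decode_def by (intro limI) (simp add: LIM_zero_iff)
qed

definition decodable :: "(int \<Rightarrow> bool) set" where
  "decodable = {\<omega>. decode \<omega> \<in> {0..<1} \<and> code (decode \<omega>) = \<omega>}"

text \<open>\<open>decodable\<close> has full measure but need not be invariant. Intersecting its
  countably many shifts gives an invariant set of full measure, so that on \<open>core\<close> the
  conjugated shift is a bijection at every point.\<close>

definition regular :: "(int \<Rightarrow> bool) set" where
  "regular = {\<omega>. \<forall>n. shift_by n \<omega> \<in> decodable}"

definition core :: "real set" where
  "core = {x \<in> {0..<1}. code x \<in> regular}"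

lemma sets_decodable [measurable]: "decodable \<in> sets spins"
proof -
  have *: "(\<lambda>\<omega>. code (decode \<omega>) n) \<in> spins \<rightarrow>\<^sub>M count_space UNIV" for n
    by (rule measurable_compose[OF measurable_compose[OF measurable_decode measurable_code]
          measurable_component_singleton]) simp
  have "{\<omega> \<in> space spins. code (decode \<omega>) n = \<omega> n} \<in> sets spins" for n
    using * by measurable
  then have "(\<Inter>n. {\<omega>. code (decode \<omega>) n = \<omega> n}) \<in> sets spins"
    by (intro sets.countable_INT'' UNIV_sets_spins countableI_type) simp
  moreover have "decode -` {0..<1} \<inter> space spins \<in> sets spins"
    by (rule measurable_sets[OF measurable_decode]) auto
  ultimately have "(decode -` {0..<1} \<inter> space spins) \<inter> (\<Inter>n. {\<omega>. code (decode \<omega>) n = \<omega> n}) \<in> sets spins"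
    by (rule sets.Int[rotated])
  also have "(decode -` {0..<1} \<inter> space spins) \<inter> (\<Inter>n. {\<omega>. code (decode \<omega>) n = \<omega> n}) = decodable"
    by (auto simp: decodable_def)
  finally show ?thesis .
qed

lemma measure_decodable: "measure law decodable = 1"
proof -
  interpret U: prob_space unit_interval by (rule prob_space_unit_interval)
  have "{x \<in> {0..<1}. code x \<in> decodable} = space unit_interval"
    by (auto simp: decodable_def decode_code space_restrict_space)
  then show ?thesis using U.prob_space by (simp only: measure_law[OF sets_decodable])
qed

lemma regular_eq: "regular = (\<Inter>n. shift_by n ` decodable)"
proof -
  have "(\<forall>n. shift_by n \<omega> \<in> decodable) \<longleftrightarrow> (\<forall>n. shift_by (- n) \<omega> \<in> decodable)" for \<omega>
    by (metis minus_minus)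
  then show ?thesis by (auto simp: regular_def shift_image)
qed

lemma sets_regular [measurable]: "regular \<in> sets spins"
  unfolding regular_eq
  by (intro sets.countable_INT'' UNIV_sets_spins countableI_type sets_shift_image sets_decodable)

lemma AE_regular: "AE \<omega> in law. \<omega> \<in> regular"
proof -
  have "AE \<omega> in law. \<omega> \<in> shift_by n ` decodable" for n
    using law.AE_in_set_eq_1[of "shift_by n ` decodable"] by (simp add: measure_shift measure_decodable)
  then have "AE \<omega> in law. \<forall>n. \<omega> \<in> shift_by n ` decodable"
    by (simp add: AE_all_countable)
  then show ?thesis by (simp add: regular_eq)
qed

lemma shift_regular: "\<omega> \<in> regular \<Longrightarrow> shift_by n \<omega> \<in> regular"
  by (simp add: regular_def)

definition rotate_by :: "int \<Rightarrow> real \<Rightarrow> real" where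
  "rotate_by n x = decode (shift_by n (code x))"

lemma code_rotate: "x \<in> core \<Longrightarrow> code (rotate_by n x) = shift_by n (code x)"
  by (auto simp: core_def regular_def decodable_def rotate_by_def)

lemma rotate_core: "x \<in> core \<Longrightarrow> rotate_by n x \<in> core"
proof -
  assume x: "x \<in> core"
  then have "shift_by n (code x) \<in> decodable" by (auto simp: core_def regular_def)
  then have "rotate_by n x \<in> {0..<1}" by (simp add: decodable_def rotate_by_def)
  with x show ?thesis
    using code_rotate[OF x, of n] shift_regular[of "code x" n] by (auto simp: core_def)
qed

lemma rotate_rotate: "x \<in> core \<Longrightarrow> rotate_by m (rotate_by n x) = rotate_by (m + n) x"
  by (simp add: rotate_by_def[of m] code_rotate) (simp add: rotate_by_def)

lemma rotate_0: "x \<in> core \<Longrightarrow> rotate_by 0 x = x"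
  by (auto simp: rotate_by_def core_def decode_code)

lemma rotate_image: "B \<subseteq> core \<Longrightarrow> rotate_by n ` B = {x \<in> core. rotate_by (- n) x \<in> B}"
proof (intro equalityI subsetI)
  fix x assume "x \<in> {x \<in> core. rotate_by (- n) x \<in> B}"
  then show "x \<in> rotate_by n ` B"
    by (intro image_eqI[of _ _ "rotate_by (- n) x"]) (auto simp: rotate_rotate rotate_0)
qed (auto simp: rotate_core rotate_rotate rotate_0 subset_iff)

section \<open>Events as subsets of the core\<close>

definition pullback :: "(int \<Rightarrow> bool) set \<Rightarrow> real set" where
  "pullback E = {x \<in> core. code x \<in> E}"

lemma pullback_subset: "pullback E \<subseteq> core"
  by (auto simp: pullback_def)

lemma rotate_pullback: "rotate_by n ` pullback E = pullback (shift_by n ` E)"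
  unfolding rotate_image[OF pullback_subset]
  by (auto simp: pullback_def code_rotate rotate_core shift_image)

text \<open>The completed measure is taken, not its Borel restriction, because
  \<open>Lebesgue_prob_space\<close> compares with \<open>lebesgue_on {0..1}\<close>.\<close>

abbreviation model :: "real measure" where
  "model \<equiv> lebesgue_on core"

lemma pullback_borel [measurable]:
  assumes "E \<in> sets spins" shows "pullback E \<in> sets borel"
proof -
  have "pullback E = {0..<1} \<inter> (code -` (E \<inter> regular) \<inter> space borel)"
    by (auto simp: pullback_def core_def)
  also have "\<dots> \<in> sets borel"
    by (intro sets.Int measurable_sets[OF measurable_code]) (use assms in auto)
  finally show ?thesis .
qed

lemma core_eq: "core = pullback UNIV"
  by (simp add: pullback_def)

lemma core_borel [measurable]: "core \<in> sets borel"
  unfolding core_eq by (rule pullback_borel[OF UNIV_sets_spins])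

lemma core_lebesgue: "core \<in> sets lebesgue"
  using core_borel by auto

lemma space_model: "space model = core"
  by (simp add: space_restrict_space)

lemma borel_model: "B \<in> sets borel \<Longrightarrow> B \<subseteq> core \<Longrightarrow> B \<in> sets model"
  by (auto simp: sets_restrict_space_iff core_lebesgue)

lemma measure_pullback:
  assumes E: "E \<in> sets spins"
  shows "measure model (pullback E) = measure law E"
proof -
  have "measure law E = measure law (E \<inter> regular)"
    by (rule law.finite_measure_eq_AE) (use E AE_regular in auto)
  also have "\<dots> = measure unit_interval {x \<in> {0..<1}. code x \<in> E \<inter> regular}"
    by (rule measure_law) (use E in auto)
  also have "{x \<in> {0..<1}. code x \<in> E \<inter> regular} = pullback E"
    by (auto simp: pullback_def core_def)
  also have "measure unit_interval (pullback E) = measure lborel (pullback E)"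
    by (rule measure_restrict_space) (auto simp: pullback_def core_def)
  also have "\<dots> = measure lebesgue (pullback E)"
    using pullback_borel[OF E] by simp
  also have "\<dots> = measure model (pullback E)"
    by (rule measure_restrict_space[symmetric]) (auto simp: core_lebesgue pullback_subset)
  finally show ?thesis ..
qed

lemma prob_space_model: "prob_space model"
proof
  have "measure model (pullback UNIV) = 1"
    using measure_pullback[OF UNIV_sets_spins] law.prob_space by simp
  then show "emeasure model (space model) = 1"
    by (metis core_eq emeasure_eq_ennreal_measure ennreal_1 measure_def space_model ennreal_top_neq_one enn2real_top zero_neq_one)
qed

sublocale model: prob_space model by (rule prob_space_model)

lemma null_sets_pullback: "E \<in> sets spins \<Longrightarrow> measure law E = 0 \<Longrightarrow> pullback E \<in> null_sets model"
  using borel_model[OF pullback_borel pullback_subset, of E] measure_pullback[of E]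
  by (auto simp: null_sets_def model.emeasure_eq_measure)

lemma borel_eq_pullback:
  assumes "S \<in> sets borel" "S \<subseteq> core"
  obtains E where "E \<in> sets spins" "S = pullback E"
proof
  have "decode -` S \<inter> space spins \<in> sets spins"
    by (rule measurable_sets[OF measurable_decode assms(1)])
  then show "decode -` S \<in> sets spins" by simp
  show "S = pullback (decode -` S)"
    using assms(2) by (auto simp: pullback_def core_def decode_code)
qed

text \<open>A Lebesgue set is a Borel set together with a subset \<open>N\<close> of a Borel null
  set \<open>N'\<close>. Images of null sets under a Borel map are not controlled in general; here
  \<open>N' \<inter> core\<close> is the pullback of a null event \<open>Z\<close>, whose shifts are
  again null, and completeness makes the image of \<open>N\<close> measurable. A single
  \<open>E\<close> serves all \<open>n\<close>.\<close>

lemma model_approx: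
  assumes "B \<in> sets model"
  obtains E where "E \<in> sets spins"
    "\<forall>n. rotate_by n ` B \<in> sets model"
    "\<forall>n. AE x in model. x \<in> rotate_by n ` B \<longleftrightarrow> x \<in> pullback (shift_by n ` E)"
proof -
  have B: "B \<in> sets lebesgue" "B \<subseteq> core"
    using assms by (auto simp: sets_restrict_space_iff core_lebesgue)
  then obtain S N N' where SN: "B = S \<union> N" "N \<subseteq> N'" "N' \<in> null_sets lborel" "S \<in> sets lborel"
    by (auto elim: sets_completionE)
  obtain E where E: "E \<in> sets spins" "S = pullback E"
    using borel_eq_pullback[of S] SN B by auto
  obtain Z where Z: "Z \<in> sets spins" "N' \<inter> core = pullback Z"
  proof (rule borel_eq_pullback[of "N' \<inter> core"])
    show "N' \<inter> core \<in> sets borel" using SN(3) by (auto simp: null_sets_def)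
  qed auto
  have "measure lebesgue (N' \<inter> core) = 0"
  proof -
    have "N' \<inter> core \<in> null_sets lborel"
      using SN(3) core_borel by (intro null_set_Int2) auto
    then show ?thesis by (simp add: measure_eq_0_null_sets null_sets_completionI)
  qed
  then have "measure model (N' \<inter> core) = 0"
    by (subst measure_restrict_space) (auto simp: core_lebesgue)
  then have Z0: "measure law Z = 0" using measure_pullback[OF Z(1)] Z(2) by simp
  have null: "pullback (shift_by n ` Z) \<in> null_sets model" for n
    using Z Z0 by (intro null_sets_pullback) (auto simp: measure_shift)
  have img: "rotate_by n ` B = pullback (shift_by n ` E) \<union> rotate_by n ` N" for n
    unfolding SN(1) E(2) image_Un rotate_pullback ..
  have "N \<subseteq> pullback Z" using SN B Z by auto
  then have sub: "rotate_by n ` N \<subseteq> pullback (shift_by n ` Z)" for n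
    unfolding rotate_pullback[symmetric] by (rule image_mono)
  show thesis
  proof (intro that[OF E(1)] allI)
    fix n
    have "rotate_by n ` N \<in> sets model"
    proof -
      have "pullback (shift_by n ` Z) \<in> null_sets lebesgue"
        using null[of n] by (auto simp: null_sets_restrict_space core_lebesgue)
      from completion.complete2[OF sub this] have "rotate_by n ` N \<in> sets lebesgue" by (rule null_setsD2)
      moreover have "rotate_by n ` N \<subseteq> core" using sub[of n] pullback_subset by auto
      ultimately show ?thesis by (auto simp: sets_restrict_space_iff core_lebesgue)
    qed
    moreover have "pullback (shift_by n ` E) \<in> sets model"
      using E by (intro borel_model pullback_borel pullback_subset) auto
    ultimately show "rotate_by n ` B \<in> sets model" unfolding img by (intro sets.Un) auto
    show "AE x in model. x \<in> rotate_by n ` B \<longleftrightarrow> x \<in> pullback (shift_by n ` E)"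
      by (rule AE_I'[OF null[of n]]) (use sub[of n] img[of n] in auto)
  qed
qed

lemma measure_rotate_Int:
  assumes "B \<in> sets model" "C \<in> sets model"
  obtains E F where "E \<in> sets spins" "F \<in> sets spins"
    "measure model B = measure law E" "measure model C = measure law F"
    "\<forall>n. rotate_by n ` B \<in> sets model"
    "\<forall>n. measure model (rotate_by n ` B \<inter> C) = measure law (shift_by n ` E \<inter> F)"
    "\<forall>n. measure model (sym_diff (rotate_by n ` B) B) = measure law (sym_diff (shift_by n ` E) E)"
proof -
  \<comment> \<open>The instance \<open>n = 0\<close> of \<open>model_approx\<close> compares
    \<open>B\<close> and \<open>C\<close> themselves with \<open>E\<close> and
    \<open>F\<close>.\<close>
  have img0: "rotate_by 0 ` X = X" "shift_by 0 ` Y = Y" if "X \<in> sets model" for X Y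
    using sets.sets_into_space[OF that] by (force simp: rotate_0 space_model)+
  obtain E where E: "E \<in> sets spins" "\<forall>n. rotate_by n ` B \<in> sets model"
    "\<forall>n. AE x in model. x \<in> rotate_by n ` B \<longleftrightarrow> x \<in> pullback (shift_by n ` E)"
    by (rule model_approx[OF assms(1)])
  obtain F where F: "F \<in> sets spins"
    "\<forall>n. AE x in model. x \<in> rotate_by n ` C \<longleftrightarrow> x \<in> pullback (shift_by n ` F)"
    by (rule model_approx[OF assms(2)])
  have pull: "pullback X \<in> sets model" if "X \<in> sets spins" for X
    using that by (intro borel_model pullback_borel pullback_subset)
  have B: "AE x in model. x \<in> B \<longleftrightarrow> x \<in> pullback E" using spec[OF E(3), of 0] assms by (simp add: img0)
  have C: "AE x in model. x \<in> C \<longleftrightarrow> x \<in> pullback F" using spec[OF F(2), of 0] assms by (simp add: img0)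
  show thesis
  proof (rule that[OF E(1) F(1) _ _ E(2)], goal_cases)
    case 1
    have "measure model B = measure model (pullback E)"
      using B E assms by (intro model.finite_measure_eq_AE) (auto intro: pull)
    then show ?case using E by (simp add: measure_pullback)
  next
    case 2
    have "measure model C = measure model (pullback F)"
      using C F assms by (intro model.finite_measure_eq_AE) (auto intro: pull)
    then show ?case using F by (simp add: measure_pullback)
  next
    case 3
    show ?case
    proof
      fix n
      have SE: "shift_by n ` E \<in> sets spins" using E by simp
      have "measure model (rotate_by n ` B \<inter> C) = measure model (pullback (shift_by n ` E \<inter> F))"
      proof (rule model.finite_measure_eq_AE)
        show "AE x in model. x \<in> rotate_by n ` B \<inter> C \<longleftrightarrow> x \<in> pullback (shift_by n ` E \<inter> F)"
          using spec[OF E(3), of n] C by eventually_elim (auto simp: pullback_def)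
      qed (use E(2) assms SE F in \<open>auto intro!: pull\<close>)
      then show "measure model (rotate_by n ` B \<inter> C) = measure law (shift_by n ` E \<inter> F)"
        using SE F by (simp add: measure_pullback sets.Int)
    qed
  next
    case 4
    show ?case
    proof
      fix n
      have SE: "shift_by n ` E \<in> sets spins" using E by simp
      have "measure model (sym_diff (rotate_by n ` B) B) = measure model (pullback (sym_diff (shift_by n ` E) E))"
      proof (rule model.finite_measure_eq_AE)
        show "AE x in model. x \<in> sym_diff (rotate_by n ` B) B \<longleftrightarrow> x \<in> pullback (sym_diff (shift_by n ` E) E)"
          using spec[OF E(3), of n] B by eventually_elim (auto simp: pullback_def)
        show "pullback (sym_diff (shift_by n ` E) E) \<in> sets model"
          by (intro pull sets.Un sets.Diff SE E)
        show "sym_diff (rotate_by n ` B) B \<in> sets model"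
          by (intro sets.Un sets.Diff spec[OF E(2)] assms)
      qed
      also have "\<dots> = measure law (sym_diff (shift_by n ` E) E)"
        by (intro measure_pullback sets.Un sets.Diff SE E)
      finally show "measure model (sym_diff (rotate_by n ` B) B) = measure law (sym_diff (shift_by n ` E) E)" .
    qed
  qed
qed

text \<open>\<open>core\<close> is a conull subset of \<open>{0..1}\<close>: after removing the null
  complement from the interval, and nothing from \<open>model\<close>, both sides are literally the
  same space and the identity is an isomorphism.\<close>

lemma Lebesgue_prob_space_model: "Lebesgue_prob_space model"
proof -
  have core_sub: "core \<subseteq> {0..1}" by (auto simp: core_def)
  have "{0..1} - ({0..1} - core) = core" using core_sub by auto
  then have eq: "restrict_space (lebesgue_on {0..1}) ({0..1} - ({0..1} - core)) = model"
    using core_sub core_lebesgue by (subst restrict_restrict_space) (auto simp: Int_absorb1)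
  have "measure lebesgue core = 1"
    using model.prob_space core_lebesgue by (simp add: measure_restrict_space space_model)
  then have "measure lebesgue ({0..1} - core) = 0"
    using core_sub core_lebesgue by (subst measure_Diff) auto
  moreover have diff: "{0..1} - core \<in> fmeasurable lebesgue"
    by (intro fmeasurable_Diff core_lebesgue) simp
  ultimately have "emeasure lebesgue ({0..1} - core) = 0"
    using emeasure_eq_measure2[OF diff] by (simp only: ennreal_0)
  then have "{0..1} - core \<in> null_sets lebesgue"
    by (rule null_setsI[OF _ fmeasurableD[OF diff]])
  then have null: "{0..1} - core \<in> null_sets (lebesgue_on {0..1})"
    by (subst null_sets_restrict_space) auto
  have "measure_isomorphic model model"
    unfolding measure_isomorphic_def by (intro exI[of _ "\<lambda>x. x"]) (auto simp: distr_id)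
  moreover have "restrict_space model (space model - {}) = model"
    by (subst restrict_restrict_space) (auto simp: core_lebesgue space_model)
  ultimately show ?thesis
    unfolding Lebesgue_prob_space_def isomorphic_mod_null_def
    using prob_space_model null eq by (intro conjI bexI[of _ "{}"] bexI[of _ "{0..1} - core"]) auto
qed

section \<open>The conjugated transformation and its properties\<close>

lemma bij_rotate: "bij_betw (rotate_by n) core core"
  by (rule bij_betw_byWitness[of _ "rotate_by (- n)"]) (auto simp: rotate_rotate rotate_0 rotate_core)

lemma inv_into_rotate: "x \<in> core \<Longrightarrow> inv_into core (rotate_by n) x = rotate_by (- n) x"
  using bij_rotate[of n]
  by (intro inv_into_f_eq) (auto simp: bij_betw_def rotate_core rotate_rotate rotate_0)

lemma measurable_rotate: "rotate_by n \<in> model \<rightarrow>\<^sub>M model"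
proof (rule measurableI)
  fix B assume B: "B \<in> sets model"
  then have "B \<subseteq> core" using sets.sets_into_space[OF B] by (simp add: space_model)
  then have "rotate_by n -` B \<inter> space model = rotate_by (- n) ` B"
    by (auto simp: rotate_image space_model)
  also have "\<dots> \<in> sets model" using model_approx[OF B] by metis
  finally show "rotate_by n -` B \<inter> space model \<in> sets model" .
qed (simp add: space_model rotate_core)

lemma distr_rotate: "distr model model (rotate_by n) = model"
proof (rule measure_eqI)
  fix B assume "B \<in> sets (distr model model (rotate_by n))"
  then have B: "B \<in> sets model" by simp
  then have "B \<subseteq> core" using sets.sets_into_space[OF B] by (simp add: space_model)
  then have eq: "rotate_by n -` B \<inter> space model = rotate_by (- n) ` B"
    by (auto simp: rotate_image space_model)
  have core: "core \<in> sets model" using sets.top[of model] by (simp only: space_model)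
  \<comment> \<open>With \<open>C = core\<close> the event \<open>F\<close> has full measure, so
    intersecting with it does not change the measure of a shifted \<open>E\<close>.\<close>
  obtain E F where E: "E \<in> sets spins" "F \<in> sets spins" "measure model B = measure law E"
    "measure model core = measure law F" "\<forall>n. rotate_by n ` B \<in> sets model"
    "\<forall>n. measure model (rotate_by n ` B \<inter> core) = measure law (shift_by n ` E \<inter> F)"
    by (rule measure_rotate_Int[OF B core])
  have F1: "measure law F = 1" using E(4) model.prob_space by (simp add: space_model)
  have "measure model (rotate_by (- n) ` B) = measure law (shift_by (- n) ` E \<inter> F)"
    using spec[OF E(6), of "- n"] \<open>B \<subseteq> core\<close> by (simp add: rotate_image Int_absorb2)
  also have "\<dots> = measure law (shift_by (- n) ` E)"
    using law.AE_in_set_eq_1[of F] F1 E by (intro law.finite_measure_eq_AE) auto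
  also have "\<dots> = measure model B" using E by (simp add: measure_shift)
  finally have "measure model (rotate_by (- n) ` B) = measure model B" .
  then show "emeasure (distr model model (rotate_by n)) B = emeasure model B"
    unfolding emeasure_distr[OF measurable_rotate B] eq by (simp only: model.emeasure_eq_measure)
qed simp

lemma invertible_mpt_rotate: "invertible_mpt model (rotate_by 1)"
proof -
  have "inv_into core (rotate_by 1) \<in> model \<rightarrow>\<^sub>M model"
    using measurable_rotate[of "- 1"]
    by (subst measurable_cong[of _ _ "rotate_by (- 1)"]) (auto simp: inv_into_rotate space_model)
  then show ?thesis
    by (simp add: invertible_mpt_def bij_rotate measurable_rotate distr_rotate space_model)
qed

text \<open>Agreement of \<open>f\<close> with \<open>rotate_by m\<close> is asked on
  \<open>core\<close> only, so that \<open>inv_into core (rotate_by 1)\<close> with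
  \<open>m = - 1\<close> is covered and negative powers follow.\<close>

lemma iterate_rotate:
  assumes "\<And>x. x \<in> core \<Longrightarrow> f x = rotate_by m x" "x \<in> core"
  shows "(f ^^ k) x = rotate_by (int k * m) x"
proof (induction k)
  case (Suc k)
  then show ?case
    using assms by (simp add: rotate_core rotate_rotate distrib_right)
qed (simp add: rotate_0 assms)

lemma iterate_rotate_image: "B \<in> sets model \<Longrightarrow> (rotate_by 1 ^^ n) ` B = rotate_by (int n) ` B"
  using sets.sets_into_space[of B model] iterate_rotate[of "rotate_by 1" 1]
  by (intro image_cong) (auto simp: space_model)

lemma int_iterate_rotate_image:
  "B \<in> sets model \<Longrightarrow> int_iterate model (rotate_by 1) n ` B = rotate_by n ` B"
proof (intro image_cong refl)
  fix x assume "B \<in> sets model" "x \<in> B"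
  then have x: "x \<in> core" using sets.sets_into_space[of B model] by (auto simp: space_model)
  show "int_iterate model (rotate_by 1) n x = rotate_by n x"
    using iterate_rotate[of "rotate_by 1" 1 x "nat n"] x
      iterate_rotate[of "inv_into core (rotate_by 1)" "- 1" x "nat (- n)"]
    by (auto simp: int_iterate_def inv_into_rotate space_model)
qed

lemma rigid_rotate:
  assumes "filterlim h at_top sequentially"
  shows "rigid model (rotate_by 1)"
  unfolding rigid_def
proof (intro exI conjI ballI)
  fix B assume B: "B \<in> sets model"
  obtain E where E: "E \<in> sets spins"
    "\<forall>n. measure model (sym_diff (rotate_by n ` B) B) = measure law (sym_diff (shift_by n ` E) E)"
    by (rule measure_rotate_Int[OF B B])
  show "(\<lambda>k. measure model (sym_diff ((rotate_by 1 ^^ h k) ` B) B)) \<longlonglongrightarrow> 0"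
    unfolding iterate_rotate_image[OF B] spec[OF E(2)] by (rule rigid_law[OF E(1)])
qed (rule assms)

lemma weak_mixing_rotate: "weak_mixing model (rotate_by 1)"
  unfolding weak_mixing_def
proof (intro ballI)
  fix B C assume B: "B \<in> sets model" and C: "C \<in> sets model"
  obtain E F where E: "E \<in> sets spins" "F \<in> sets spins"
    "measure model B = measure law E" "measure model C = measure law F"
    "\<forall>n. measure model (rotate_by n ` B \<inter> C) = measure law (shift_by n ` E \<inter> F)"
    by (rule measure_rotate_Int[OF B C])
  show "(\<lambda>N. 1 / real N * (\<Sum>n<N. \<bar>measure model ((rotate_by 1 ^^ n) ` B \<inter> C) -
      measure model B * measure model C\<bar>)) \<longlonglongrightarrow> 0"
    unfolding iterate_rotate_image[OF B] E(3,4) spec[OF E(5)]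
    using weak_mixing_law[OF E(1,2)] unfolding mean_abs_def correlation_def .
qed

lemma overindependent_rotate:
  assumes "(\<phi> {0})\<^sup>2 < \<phi> {0, n}"
  shows "(measure model (pullback (all_ones {0})))\<^sup>2 <
    measure model (int_iterate model (rotate_by 1) n ` pullback (all_ones {0}) \<inter> pullback (all_ones {0}))"
proof -
  have A: "pullback (all_ones {0}) \<in> sets model"
    by (intro borel_model pullback_borel pullback_subset sets_all_ones)
  have "int_iterate model (rotate_by 1) n ` pullback (all_ones {0}) \<inter> pullback (all_ones {0}) =
      pullback (all_ones {0, n})"
    unfolding int_iterate_rotate_image[OF A] rotate_pullback shift_all_ones
    by (auto simp: pullback_def all_ones_def)
  then show ?thesis using assms by (simp add: measure_pullback measure_all_ones)
qed

end

section \<open>The functional given by the limiting capacity\<close>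

lemma exp_minus_Lipschitz:
  assumes "0 \<le> (x::real)" "0 \<le> y"
  shows "\<bar>exp (- x) - exp (- y)\<bar> \<le> \<bar>x - y\<bar>"
proof -
  have *: "exp (- x) - exp (- y) \<le> y - x" if "0 \<le> x" "x \<le> y" for x y :: real
  proof -
    have "exp (- x) - exp (- y) = exp (- x) * (1 - exp (x - y))"
      by (simp add: algebra_simps flip: exp_add)
    also have "\<dots> \<le> 1 * (1 - exp (x - y))"
      using that by (intro mult_right_mono) auto
    also have "\<dots> \<le> y - x" using exp_ge_add_one_self[of "x - y"] by argo
    finally show ?thesis .
  qed
  show ?thesis
  proof (cases "x \<le> y")
    case True
    then show ?thesis using *[of x y] assms by (auto simp: abs_if)
  next
    case False
    then show ?thesis using *[of y x] assms by (auto simp: abs_if)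
  qed
qed

text \<open>Exponentiation turns additivity of capacities into independence, and
  \<open>exp_minus_Lipschitz\<close> bounds each correlation by the additivity defect averaged in
  \<open>cesaro_lim_capacity\<close>. The value at \<open>{0}\<close> is \<open>exp (- 1)\<close>,
  which settles \<open>nontrivial\<close>.\<close>

interpretation radix_void: mixing_void_functional "\<lambda>F. exp (- lim_capacity F)" "\<lambda>k. nat (radix k)"
proof
  show "completely_monotone (\<lambda>F. exp (- lim_capacity F))"
    by (rule completely_monotone_exp_lim_capacity)
  show "exp (- lim_capacity ((+) n ` F)) = exp (- lim_capacity F)" for n F
    by (simp add: lim_capacity_translate)
  show "mean_abs (\<lambda>n. exp (- lim_capacity ((+) (int n) ` F \<union> G)) - exp (- lim_capacity F) * exp (- lim_capacity G))
      \<longlonglongrightarrow> 0" if FG: "finite F" "finite G" for F G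
  proof (rule tendsto_sandwich[OF _ _ tendsto_const cesaro_lim_capacity[OF FG]])
    have "\<bar>exp (- lim_capacity ((+) (int n) ` F \<union> G)) - exp (- lim_capacity F) * exp (- lim_capacity G)\<bar>
      \<le> \<bar>lim_capacity F + lim_capacity G - lim_capacity ((+) (int n) ` F \<union> G)\<bar>" for n
      using exp_minus_Lipschitz[of "lim_capacity ((+) (int n) ` F \<union> G)" "lim_capacity F + lim_capacity G"] FG
      by (simp add: lim_capacity_nonneg exp_add[symmetric] abs_minus_commute)
    then show "\<forall>\<^sub>F N in sequentially.
        mean_abs (\<lambda>n. exp (- lim_capacity ((+) (int n) ` F \<union> G)) - exp (- lim_capacity F) * exp (- lim_capacity G)) N
        \<le> 1 / real N * (\<Sum>n<N. \<bar>lim_capacity F + lim_capacity G - lim_capacity ((+) (int n) ` F \<union> G)\<bar>)"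
      unfolding mean_abs_def by (intro always_eventually allI mult_left_mono sum_mono) auto
  qed (simp add: mean_abs_nonneg)
  show "(\<lambda>k. exp (- lim_capacity ((+) (int (nat (radix k))) ` F \<union> F))) \<longlonglongrightarrow> exp (- lim_capacity F)"
    if "finite F" for F
    using lim_capacity_rigid[OF that] by (auto intro!: tendsto_intros)
qed (simp_all add: lim_capacity_empty lim_capacity_zero)

theorem theorem3p5:
  shows "\<exists>(M :: real measure) (T :: real \<Rightarrow> real) A.
    Lebesgue_prob_space M \<and> invertible_mpt M T \<and> rigid M T \<and> weak_mixing M T \<and>
    A \<in> sets M \<and>
    (\<forall>n::int. measure M (int_iterate M T n ` A \<inter> A) > (measure M A)\<^sup>2)"
proof (intro exI conjI allI)
  show "Lebesgue_prob_space radix_void.model" by (rule radix_void.Lebesgue_prob_space_model)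
  show "invertible_mpt radix_void.model (radix_void.rotate_by 1)"
    by (rule radix_void.invertible_mpt_rotate)
  show "rigid radix_void.model (radix_void.rotate_by 1)"
  proof (rule radix_void.rigid_rotate)
    have "k \<le> nat (radix k)" for k using radix_unbounded[of k] by simp
    then show "filterlim (\<lambda>k. nat (radix k)) at_top sequentially"
      by (intro filterlim_at_top_mono[OF filterlim_ident]) auto
  qed
  show "weak_mixing radix_void.model (radix_void.rotate_by 1)"
    by (rule radix_void.weak_mixing_rotate)
  show "radix_void.pullback (all_ones {0}) \<in> sets radix_void.model"
    by (intro radix_void.borel_model radix_void.pullback_borel radix_void.pullback_subset sets_all_ones)
  \<comment> \<open>Since \<open>lim_capacity {0} = 1\<close>, the left side is
    \<open>exp (- 2)\<close>, and the strict bound \<open>lim_capacity {0, n} < 2\<close> is exactly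
    what is required.\<close>
  have "(exp (- lim_capacity {0}))\<^sup>2 < exp (- lim_capacity {0, n})" for n
    using lim_capacity_pair[of n] by (simp add: lim_capacity_zero flip: exp_of_nat_mult)
  then show "(measure radix_void.model (radix_void.pullback (all_ones {0})))\<^sup>2 <
      measure radix_void.model (int_iterate radix_void.model (radix_void.rotate_by 1) n `
        radix_void.pullback (all_ones {0}) \<inter> radix_void.pullback (all_ones {0}))" for n
    by (rule radix_void.overindependent_rotate)
qed

end
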